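(* Let $M_1,M_2$ be simple matroids and let $\Gamma_f\colon B(M_1)\vdash B(M_2)$ be the graph correspondence of a covering lattice map $f\colon\mathcal F(M_1)\to\mathcal F(M_2)$. Let $(\mathcal G,\omega_{\mathcal G})$ be the pair for which $\Gamma_f$ is a Flag fan. Then all the edges (covering relations) of $\mathcal G$ are of the form $$(X_1,Y_1)\lessdot_{\mathcal G}(X_2,Y_2),\quad\text{where } Y_1\lessdot_{M_2}Y_2,\ f(X_1)\le_{M_2}Y_1\ \text{and}\ X_1\le_{M_1}X_2 .$$ Denote by $\mathcal F(X_1,X_2,Y_1)$ the subposet of $\mathcal F(M_1)$ consisting of those $F$ with $X_1\le_{M_1}F\le_{M_1}X_2$ and $f(F)\le_{M_2}Y_1$. Then $$\omega_{\mathcal G}\bigl((X_1,Y_1),(X_2,Y_2)\bigr)=\eta_{\mathcal F(X_1,X_2,Y_1)}(X_1).$$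
   Context: Matroids. A matroid $M$ on a finite set $E=E(M)$ is given by its lattice of flats $\mathcal F(M)\subset2^E$ (order $\le_M$, covering relation $\lessdot_M$), with rank function $\mathrm{rk}_M$; it is simple if $\varnothing$ and all one-element subsets are flats. $M_1\oplus M_2$ has flats $(F_1,F_2)=F_1\sqcup F_2$. Lattice maps. A weak lattice map $f\colon\mathcal F(M_1)\to\mathcal F(M_2)$ is an order-preserving map with $f(F)\neq\varnothing$ for $F\ne\varnothing$ and $\mathrm{rk}_{M_1}F\ge\mathrm{rk}_{M_2}f(F)$. It is covering if whenever $F$ covers $F'$, either $f(F)$ covers $f(F')$ or $f(F)=f(F')$. Möbius function. On a finite poset $\mathcal P$: $\mu(A,A)=1$, $\mu(A,B)=-\sum_{A\le C<B}\mu(A,C)$. Put $\eta_{\mathcal P}(x)=\sum_{b\ge_{\mathcal P}x}\mu_{\mathcal P}(x,b)$. Tropical fans. A $k$-dimensional tropical fan is a finite collection of $k$-dimensional rational cones with integer weights, balanced at each $(k-1)$-dimensional face $\tau$: $\sum_{\sigma\supset\tau}\omega(\sigma)u_{\sigma/\tau}=0$ modulo the span of $\tau$, with $u_{\sigma/\tau}$ the primitive lattice normal vector pointing into $\sigma$. The Bergman fan $B(M)\subset\mathbb R^E$ has maximal cones $\langle e_{F_1},\dots,e_{F_{r-1}},\pm e_E\rangle$ for all maximal flags of flats $\varnothing=F_0\lessdot\dots\lessdot F_r=E$, with weights $1$ ($e_F$ is the characteristic vector of $F$). As cycles (fans up to common refinement) $B(M_1)\times B(M_2)=B(M_1\oplus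 M_2)$. A rational function $\phi$ is continuous and linear on cones, with $\phi(-e_E)=-\phi(e_E)$, and specified by values $\phi(F)=\phi(e_F)$. Its Weil divisor $\phi\cdot X$ has weights $\omega_{\phi\cdot X}(\tau)=\sum_{\sigma\supset\tau}\omega_X(\sigma)\phi(v_{\sigma/\tau})-\phi\bigl(\sum_{\sigma\supset\tau}\omega_X(\sigma)v_{\sigma/\tau}\bigr)$ on codimension-one cones, $v_{\sigma/\tau}$ a representative of $u_{\sigma/\tau}$. Graph correspondence. For $1\le i\le\mathrm{rk}\,M_1$, $\gamma_i(f)$ is the rational function on $B(M_1\oplus M_2)$ with value on $(F_1,F_2)$ equal to $0$ if $\mathrm{rk}_{M_2}(f(F_1)\cup F_2)+\mathrm{rk}\,M_1-i\ge\mathrm{rk}_{M_1}F_1+\mathrm{rk}_{M_2}F_2$, and $-1$ otherwise. $\Gamma_f=\prod_{i=1}^{\mathrm{rk}\,M_1}\gamma_i(f)\cdot(B(M_1)\times B(M_2))$. Flag fans. A pair $(\mathcal G,\omega_{\mathcal G})$ consists of a ranked poset $\mathcal G$ of subsets of $E$ with $\varnothing,E\in\mathcal G$, such that $X\le_{\mathcal G}X'$ implies $X\subset X'$ (not necessarily conversely), and of an integer edge weight $\omega_{\mathcal G}(F,F')$ for each $F\lessdot_{\mathcal G}F'$. The Flag fan of the pair is the tropical fan in $\mathbb R^E$ whose cones are generated by characteristic vectors of flags (sets of pairwise comparable elements), the maximal cone of $\varnothing=F_0\lessdot\dots\lessdot F_r=E$ having weight $\prod_{i=0}^{r-1}\omega_{\mathcal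 G}(F_i,F_{i+1})$, together with copies of the cones with $e_E$ replaced by $-e_E$, with the same weights. The pair of $\Gamma_f$. $(\mathcal G,\omega_{\mathcal G})$ is obtained from $\mathcal F(M_1\oplus M_2)$ with all edge weights $1$ by performing, successively for $\phi=\gamma_1(f),\gamma_2(f),\dots,\gamma_{\mathrm{rk}\,M_1}(f)$, the following modification of the current pair (with current Flag fan $X$), which produces a pair for the Flag fan $\phi\cdot X$: (i) delete all covers $F\lessdot F'$ with $\phi(F)\ne\phi(F')$ (where $\phi(\varnothing)=0$); (ii) for all segments $[F,F'']$ of length $2$ in the poset before step (i) with $\phi(F)\neq\phi(F'')$, add the cover $F\lessdot F''$ with weight $\sum_{F'}\omega(F,F')\omega(F',F'')\phi(F')-\phi\bigl(\sum_{F'}\omega(F,F')\omega(F',F'')e_{F'\setminus F}\bigr)$, sums over $F\lessdot F'\lessdot F''$, if this number is nonzero, where in the second term $\phi$ is considered on the $2$-dimensional Flag fan of the segment in $\mathbb R^{F''\setminus F}$, with $\phi(e_{F'\setminus F})=\phi(F')$ and $\phi(e_{F''\setminus F})=\phi(F'')$; (iii) delete vertices not in the same connected component of the resulting graph of covers as $\varnothing$ and $E$.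
   Formalization: In step (iii) of the construction of the pair, the vertices kept are those lying on a chain of covers from ∅ to E, instead of those in the undirected connected component of ∅ and E, which keeps dangling vertices and makes the claim false (e.g. for a map from U_{2,2} to U_{2,3}). *)

theory Defs
  imports Main
begin

section \<open>Posets and the Moebius function\<close>

definition covered :: "'v set \<Rightarrow> ('v \<Rightarrow> 'v \<Rightarrow> bool) \<Rightarrow> 'v \<Rightarrow> 'v \<Rightarrow> bool" where
  "covered V le A B \<longleftrightarrow> A \<in> V \<and> B \<in> V \<and> le A B \<and> A \<noteq> B \<and>
     (\<forall>C\<in>V. le A C \<and> le C B \<longrightarrow> C = A \<or> C = B)"

text \<open>The finiteness guard only makes the recursion total; the value is meaningful for finite
  \<open>P\<close> and \<open>A, B \<in> P\<close>. For \<open>A \<le> B\<close> failing, the sum is empty and the value is \<open>0\<close>.\<close>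

function mobius :: "'v::order set \<Rightarrow> 'v \<Rightarrow> 'v \<Rightarrow> int" where
  "mobius P A B =
     (if A = B then 1
      else if finite P then - (\<Sum>C\<in>{C\<in>P. A \<le> C \<and> C < B}. mobius P A C)
      else 0)"
  by pat_completeness auto
termination
proof (relation "measure (\<lambda>(P, A, B). card {C\<in>P. C < B})")
  fix P :: "'v::order set" and A B C
  assume "finite P" and C: "C \<in> {C\<in>P. A \<le> C \<and> C < B}"
  then have "{D\<in>P. D < C} \<subset> {D\<in>P. D < B}" by auto
  with \<open>finite P\<close> show "((P, A, C), (P, A, B)) \<in> measure (\<lambda>(P, A, B). card {C\<in>P. C < B})"
    by (simp add: psubset_card_mono)
qed simp

declare mobius.simps [simp del]

definition eta :: "'v::order set \<Rightarrow> 'v \<Rightarrow> int" where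
  "eta P x = (\<Sum>b\<in>{b\<in>P. x \<le> b}. mobius P x b)"

section \<open>Matroids given by their lattices of flats\<close>

locale matroid =
  fixes E :: "'a set" and L :: "'a set set"
  assumes finite_ground: "finite E"
    and flats_subset: "L \<subseteq> Pow E"
    and ground_flat: "E \<in> L"
    and flats_Int: "F \<in> L \<Longrightarrow> G \<in> L \<Longrightarrow> F \<inter> G \<in> L"
    and flats_partition: "F \<in> L \<Longrightarrow> x \<in> E - F \<Longrightarrow> \<exists>!G. covered L (\<subseteq>) F G \<and> x \<in> G"

locale simple_matroid = matroid +
  assumes empty_flat: "{} \<in> L"
    and singleton_flat: "x \<in> E \<Longrightarrow> {x} \<in> L"

definition flat_closure :: "'a set set \<Rightarrow> 'a set \<Rightarrow> 'a set" where
  "flat_closure L A = \<Inter>{F\<in>L. A \<subseteq> F}"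

text \<open>Rank of an arbitrary subset of the ground set: the length of a longest chain of flats below
  its closure.\<close>

definition flat_rank :: "'a set set \<Rightarrow> 'a set \<Rightarrow> nat" where
  "flat_rank L A = Max {card C - 1 | C. subset.chain {F\<in>L. F \<subseteq> flat_closure L A} C}"

definition direct_sum :: "'a set set \<Rightarrow> 'b set set \<Rightarrow> ('a + 'b) set set" where
  "direct_sum L1 L2 = {X <+> Y | X Y. X \<in> L1 \<and> Y \<in> L2}"

definition weak_lattice_map :: "'a set set \<Rightarrow> 'b set set \<Rightarrow> ('a set \<Rightarrow> 'b set) \<Rightarrow> bool" where
  "weak_lattice_map L1 L2 f \<longleftrightarrow>
     (\<forall>F\<in>L1. f F \<in> L2) \<and>
     (\<forall>F\<in>L1. \<forall>G\<in>L1. F \<subseteq> G \<longrightarrow> f F \<subseteq> f G) \<and>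
     (\<forall>F\<in>L1. F \<noteq> {} \<longrightarrow> f F \<noteq> {}) \<and>
     (\<forall>F\<in>L1. flat_rank L2 (f F) \<le> flat_rank L1 F)"

definition covering_lattice_map :: "'a set set \<Rightarrow> 'b set set \<Rightarrow> ('a set \<Rightarrow> 'b set) \<Rightarrow> bool" where
  "covering_lattice_map L1 L2 f \<longleftrightarrow> weak_lattice_map L1 L2 f \<and>
     (\<forall>F G. covered L1 (\<subseteq>) F G \<longrightarrow> covered L2 (\<subseteq>) (f F) (f G) \<or> f F = f G)"

section \<open>Weighted posets of subsets and their modification along a rational function\<close>

text \<open>The pairs underlying Flag fans. The relation \<open>le\<close> is relevant on \<open>verts\<close> only, the weight
  \<open>wt\<close> only on the covering relations.\<close>

record 'c flag_pair =
  verts :: "'c set set"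
  le :: "'c set \<Rightarrow> 'c set \<Rightarrow> bool"
  wt :: "'c set \<Rightarrow> 'c set \<Rightarrow> int"

definition pair_covers :: "'c flag_pair \<Rightarrow> 'c set \<Rightarrow> 'c set \<Rightarrow> bool" where
  "pair_covers G = covered (verts G) (le G)"

definition char_vec :: "'c set \<Rightarrow> 'c \<Rightarrow> int" where
  "char_vec A x = of_bool (x \<in> A)"

text \<open>Value at the lattice vector \<open>v\<close> of the rational function \<open>\<phi>\<close> on the Flag fan of the
  segment \<open>[A, B]\<close> in \<open>\<real>\<^bsup>B - A\<^esup>\<close>. Its cones are generated by the vectors \<open>e\<^bsub>X - A\<^esub>\<close> with \<open>X\<close>
  running through a flag \<open>C\<close> in \<open>(A, B]\<close>, where \<open>e\<^bsub>B - A\<^esub>\<close> may also be replaced by its negative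
  (so its coefficient has no sign condition); \<open>\<phi>\<close> is linear on each cone with value \<open>\<phi> X\<close> at
  \<open>e\<^bsub>X - A\<^esub>\<close>. These cones are unimodular, so that integer coefficients suffice for lattice
  vectors. Vectors outside the support of the fan get an unspecified value.\<close>

definition segment_fan_value ::
    "'c flag_pair \<Rightarrow> ('c set \<Rightarrow> int) \<Rightarrow> 'c set \<Rightarrow> 'c set \<Rightarrow> ('c \<Rightarrow> int) \<Rightarrow> int" where
  "segment_fan_value G \<phi> A B v = (THE t. \<exists>C c.
     C \<subseteq> {X \<in> verts G. le G A X \<and> X \<noteq> A \<and> le G X B} \<and>
     (\<forall>X\<in>C. \<forall>Y\<in>C. le G X Y \<or> le G Y X) \<and>
     (\<forall>X\<in>C - {B}. 0 \<le> c X) \<and>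
     v = (\<lambda>x. \<Sum>X\<in>C. c X * char_vec (X - A) x) \<and>
     t = (\<Sum>X\<in>C. c X * \<phi> X))"

definition between :: "'c flag_pair \<Rightarrow> 'c set \<Rightarrow> 'c set \<Rightarrow> 'c set set" where
  "between G A B = {X. pair_covers G A X \<and> pair_covers G X B}"

definition segment_weight ::
    "'c flag_pair \<Rightarrow> ('c set \<Rightarrow> int) \<Rightarrow> 'c set \<Rightarrow> 'c set \<Rightarrow> int" where
  "segment_weight G \<phi> A B =
     (\<Sum>X\<in>between G A B. wt G A X * wt G X B * \<phi> X)
     - segment_fan_value G \<phi> A B
         (\<lambda>x. \<Sum>X\<in>between G A B. wt G A X * wt G X B * char_vec (X - A) x)"

text \<open>The graph of covers after deletion of the covers along which \<open>\<phi>\<close> changes and addition of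
  those coming from segments of length two.\<close>

definition modified_edges :: "'c flag_pair \<Rightarrow> ('c set \<Rightarrow> int) \<Rightarrow> 'c set \<Rightarrow> 'c set \<Rightarrow> bool" where
  "modified_edges G \<phi> A B \<longleftrightarrow>
     (pair_covers G A B \<and> \<phi> A = \<phi> B) \<or>
     (between G A B \<noteq> {} \<and> \<phi> A \<noteq> \<phi> B \<and> segment_weight G \<phi> A B \<noteq> 0)"

text \<open>The vertices that survive are those connected to both \<open>\<emptyset>\<close> and \<open>E\<close> by (monotone) flags of
  covers, i.e. those lying on a flag from \<open>\<emptyset>\<close> to \<open>E\<close>. Connectivity in the underlying undirected
  graph would not do: already the coatoms of the product lattice, which support no cone after a
  truncation, are joined to \<open>\<emptyset>\<close> from below.\<close>

definition modified_verts :: "'c set \<Rightarrow> 'c flag_pair \<Rightarrow> ('c set \<Rightarrow> int) \<Rightarrow> 'c set set" where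
  "modified_verts E G \<phi> =
     {X \<in> verts G. (modified_edges G \<phi>)\<^sup>*\<^sup>* {} X \<and> (modified_edges G \<phi>)\<^sup>*\<^sup>* X E}"

definition modify :: "'c set \<Rightarrow> ('c set \<Rightarrow> int) \<Rightarrow> 'c flag_pair \<Rightarrow> 'c flag_pair" where
  "modify E \<phi> G = \<lparr>
     verts = modified_verts E G \<phi>,
     le = (\<lambda>A B. A \<in> modified_verts E G \<phi> \<and> B \<in> modified_verts E G \<phi> \<and>
                  (modified_edges G \<phi>)\<^sup>*\<^sup>* A B),
     wt = (\<lambda>A B. if \<phi> A = \<phi> B then wt G A B else segment_weight G \<phi> A B)\<rparr>"

section \<open>The pair of the graph correspondence of a lattice map\<close>

text \<open>The rational function \<open>\<gamma>\<^sub>i(f)\<close> on the Bergman fan of the direct sum, with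
  \<open>F = F\<^sub>1 \<squnion> F\<^sub>2\<close>. The truncated difference is harmless since only \<open>i \<le> rk M\<^sub>1\<close> is used.\<close>

definition gamma_fun ::
    "'a set \<Rightarrow> 'a set set \<Rightarrow> 'b set set \<Rightarrow> ('a set \<Rightarrow> 'b set) \<Rightarrow> nat \<Rightarrow> ('a + 'b) set \<Rightarrow> int" where
  "gamma_fun E1 L1 L2 f i F = (let F1 = Inl -` F; F2 = Inr -` F in
     if flat_rank L2 (f F1 \<union> F2) + (flat_rank L1 E1 - i) \<ge> flat_rank L1 F1 + flat_rank L2 F2
     then 0 else - 1)"

definition bergman_pair :: "'c set set \<Rightarrow> 'c flag_pair" where
  "bergman_pair L = \<lparr>verts = L, le = (\<subseteq>), wt = (\<lambda>_ _. 1)\<rparr>"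

definition graph_pair ::
    "'a set \<Rightarrow> 'a set set \<Rightarrow> 'b set \<Rightarrow> 'b set set \<Rightarrow> ('a set \<Rightarrow> 'b set) \<Rightarrow> ('a + 'b) flag_pair" where
  "graph_pair E1 L1 E2 L2 f =
     fold (\<lambda>i. modify (E1 <+> E2) (gamma_fun E1 L1 L2 f i)) [1..<Suc (flat_rank L1 E1)]
       (bergman_pair (direct_sum L1 L2))"

end

theory Submission
  imports Defs
begin

text \<open>
  Call \<open>rk F\<^sub>1 + rk F\<^sub>2 - rk (f F\<^sub>1 \<union> F\<^sub>2)\<close> the defect of \<open>(F\<^sub>1, F\<^sub>2)\<close>. Because \<open>f\<close> is covering, the
  defect is monotone, and the function \<open>\<gamma>\<^sub>i(f)\<close> is \<open>0\<close> exactly on the flats of defect at most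
  \<open>m = rk M\<^sub>1 - i\<close>. All intermediate pairs admit a closed description. After the step with threshold
  \<open>m\<close>, every vertex \<open>(X, Y)\<close> of defect at least \<open>m\<close> satisfies \<open>f X \<subseteq> Y\<close>; the covers are the
  inclusions \<open>(X\<^sub>1, Y\<^sub>1) \<subseteq> (X\<^sub>2, Y\<^sub>2)\<close> along which \<open>min (defect) m + rk (f X \<union> Y)\<close> grows by one and
  whose weight is nonzero, the weight being \<open>\<eta>\<^bsub>\<F>(X\<^sub>1,X\<^sub>2,Y\<^sub>1)\<^esub>(X\<^sub>1)\<close> if \<open>(X\<^sub>1, Y\<^sub>1)\<close> has defect at least
  \<open>m\<close> and \<open>1\<close> otherwise. That this description is preserved by the next step comes down to Moebius
  inversion in the form \<open>\<Sum>\<^bsub>y \<ge> x\<^esub> \<eta>(y) = 1\<close>. The case \<open>m = 0\<close> is the theorem.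
\<close>

section \<open>Moebius inversion\<close>

lemma mobius_refl [simp]: "mobius P A A = 1"
  by (simp add: mobius.simps)

lemma sum_mobius:
  assumes "finite P" "A \<in> P" "B \<in> P" "A \<le> B"
  shows "(\<Sum>C\<in>{C\<in>P. A \<le> C \<and> C \<le> B}. mobius P A C) = of_bool (A = B)"
proof (cases "A = B")
  case True
  then have "{C\<in>P. A \<le> C \<and> C \<le> B} = {A}" using assms by auto
  then show ?thesis using True by simp
next
  case False
  have "{C\<in>P. A \<le> C \<and> C \<le> B} = insert B {C\<in>P. A \<le> C \<and> C < B}"
    using assms by auto
  moreover have "mobius P A B = - (\<Sum>C\<in>{C\<in>P. A \<le> C \<and> C < B}. mobius P A C)"
    using False \<open>finite P\<close> by (subst mobius.simps) simp
  ultimately show ?thesis using False \<open>finite P\<close> by simp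
qed

text \<open>The recursion inverts the zeta function on one side only; this is the other side.
  Summing \<open>mobius P C D\<close> over all pairs C \<le> D in [A, B] gives 1 by
  \<open>sum_mobius\<close>. By induction the part belonging to an upper end D < B is 1 for D = A
  and 0 otherwise, which leaves the claim for D = B.\<close>

lemma sum_mobius_dual:
  assumes "finite P" "A \<in> P" "B \<in> P" "A \<le> B"
  shows "(\<Sum>C\<in>{C\<in>P. A \<le> C \<and> C \<le> B}. mobius P C B) = of_bool (A = B)"
  using assms(3,4)
proof (induction "card {C\<in>P. C < B}" arbitrary: B rule: less_induct)
  case less
  define I where "I = {C\<in>P. A \<le> C \<and> C \<le> B}"
  define h where "h = (\<lambda>D. \<Sum>C\<in>{C\<in>I. C \<le> D}. mobius P C D)"
  have fin: "finite I" using \<open>finite P\<close> by (simp add: I_def)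
  have B: "B \<in> I" using less by (simp add: I_def)
  have A: "A \<in> I" using less \<open>A \<in> P\<close> by (simp add: I_def)
  have h: "h D = (\<Sum>C\<in>{C\<in>P. A \<le> C \<and> C \<le> D}. mobius P C D)" if "D \<in> I" for D
    unfolding h_def by (rule sum.cong) (use that in \<open>auto simp: I_def\<close>)
  have "(\<Sum>D\<in>I. h D) = (\<Sum>C\<in>I. \<Sum>D\<in>{D\<in>I. C \<le> D}. mobius P C D)"
    unfolding h_def by (rule sum.swap_restrict) (use fin in auto)
  also have "\<dots> = (\<Sum>C\<in>I. of_bool (C = B))"
  proof (rule sum.cong)
    fix C assume C: "C \<in> I"
    have "{D\<in>I. C \<le> D} = {D\<in>P. C \<le> D \<and> D \<le> B}" using C by (auto simp: I_def)
    then show "(\<Sum>D\<in>{D\<in>I. C \<le> D}. mobius P C D) = of_bool (C = B)"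
      using sum_mobius[OF \<open>finite P\<close>, of C B] C less by (auto simp: I_def)
  qed simp
  also have "\<dots> = 1" using fin B by (simp add: of_bool_def)
  finally have total: "(\<Sum>D\<in>I. h D) = 1" .
  have smaller: "h D = of_bool (A = D)" if D: "D \<in> I" "D \<noteq> B" for D
  proof -
    have "D < B" using D by (auto simp: I_def)
    then have "{C\<in>P. C < D} \<subset> {C\<in>P. C < B}" using D by (auto simp: I_def)
    then have "card {C\<in>P. C < D} < card {C\<in>P. C < B}"
      using \<open>finite P\<close> by (simp add: psubset_card_mono)
    then show ?thesis using less(1)[of D] D h by (simp add: I_def)
  qed
  have "(\<Sum>D\<in>I. h D) = h B + (\<Sum>D\<in>I - {B}. of_bool (A = D))"
    using fin B smaller by (simp add: sum.remove)
  \<comment> \<open>If A and B differ, A itself is one of the summation indices and uses up the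
    whole total, so that \<open>h B\<close> is 0.\<close>
  also have "(\<Sum>D\<in>I - {B}. of_bool (A = D)) = (of_bool (A \<noteq> B) :: int)"
    using fin A by (simp add: of_bool_def)
  finally show ?case using total h[OF B] by (auto simp: of_bool_def split: if_splits)
qed

text \<open>Exchanging the sums turns the left side into sums of \<open>mobius P y b\<close> over y
  in [x, b], which vanish except for b = x.\<close>

lemma sum_eta:
  assumes "finite P" "x \<in> P"
  shows "(\<Sum>y\<in>{y\<in>P. x \<le> y}. eta P y) = 1"
proof -
  let ?U = "{y\<in>P. x \<le> y}"
  have fin: "finite ?U" using assms by simp
  have "(\<Sum>y\<in>?U. eta P y) = (\<Sum>y\<in>?U. \<Sum>b\<in>{b\<in>?U. y \<le> b}. mobius P y b)"
    unfolding eta_def by (intro sum.cong) auto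
  also have "\<dots> = (\<Sum>b\<in>?U. \<Sum>y\<in>{y\<in>?U. y \<le> b}. mobius P y b)"
    by (rule sum.swap_restrict[OF fin fin])
  also have "\<dots> = (\<Sum>b\<in>?U. of_bool (x = b))"
  proof (rule sum.cong)
    fix b assume b: "b \<in> ?U"
    have "{y\<in>?U. y \<le> b} = {y\<in>P. x \<le> y \<and> y \<le> b}" by auto
    then show "(\<Sum>y\<in>{y\<in>?U. y \<le> b}. mobius P y b) = of_bool (x = b)"
      using sum_mobius_dual[OF assms, of b] b by simp
  qed simp
  also have "\<dots> = 1" using assms by (simp add: of_bool_def)
  finally show ?thesis .
qed

text \<open>The recursion for \<open>mobius P A B\<close> visits only elements above A, hence above
  y. This allows eta values taken in different up-sets of one poset to be compared.\<close>

lemma mobius_upset: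
  assumes "finite P" "y \<le> A"
  shows "mobius {z\<in>P. y \<le> z} A B = mobius P A B"
proof (induction "card {C\<in>P. C < B}" arbitrary: B rule: less_induct)
  case less
  have "mobius {z\<in>P. y \<le> z} A C = mobius P A C" if "C \<in> P" "C < B" for C
  proof -
    have "{D\<in>P. D < C} \<subset> {D\<in>P. D < B}" using that by auto
    then show ?thesis using less \<open>finite P\<close> by (simp add: psubset_card_mono)
  qed
  moreover have "{C \<in> {z\<in>P. y \<le> z}. A \<le> C \<and> C < B} = {C\<in>P. A \<le> C \<and> C < B}"
    using \<open>y \<le> A\<close> by auto
  ultimately have "(\<Sum>C\<in>{C \<in> {z\<in>P. y \<le> z}. A \<le> C \<and> C < B}. mobius {z\<in>P. y \<le> z} A C) =
      (\<Sum>C\<in>{C\<in>P. A \<le> C \<and> C < B}. mobius P A C)"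
    by (intro sum.cong) auto
  then show ?case
    using \<open>finite P\<close> mobius.simps[of P A B] mobius.simps[of "{z\<in>P. y \<le> z}" A B] by simp
qed

lemma eta_upset:
  assumes "finite P"
  shows "eta {z\<in>P. x \<le> z} x = eta P x"
  unfolding eta_def by (intro sum.cong) (use assms mobius_upset in auto)

section \<open>Flats and their ranks\<close>

context matroid
begin

abbreviation flat_cover :: "'a set \<Rightarrow> 'a set \<Rightarrow> bool" where
  "flat_cover \<equiv> covered L (\<subseteq>)"

abbreviation cl :: "'a set \<Rightarrow> 'a set" where
  "cl \<equiv> flat_closure L"

abbreviation rk :: "'a set \<Rightarrow> nat" where
  "rk \<equiv> flat_rank L"

lemma flat_subset: "F \<in> L \<Longrightarrow> F \<subseteq> E"
  using flats_subset by auto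

lemma finite_flats: "finite L"
  using finite_ground flats_subset by (meson finite_Pow_iff finite_subset)

lemma cl_flat:
  assumes "A \<subseteq> E"
  shows "cl A \<in> L"
proof -
  have "\<Inter>S \<in> L" if "finite S" "S \<noteq> {}" "S \<subseteq> L" for S
    using that by (induction rule: finite_ne_induct) (auto intro: flats_Int)
  moreover have "finite {F\<in>L. A \<subseteq> F}" "{F\<in>L. A \<subseteq> F} \<noteq> {}"
    using finite_flats ground_flat assms by auto
  ultimately show ?thesis by (simp add: flat_closure_def)
qed

lemma subset_cl: "A \<subseteq> cl A"
  by (auto simp: flat_closure_def)

lemma cl_least: "F \<in> L \<Longrightarrow> A \<subseteq> F \<Longrightarrow> cl A \<subseteq> F"
  by (auto simp: flat_closure_def)

lemma cl_mono: "A \<subseteq> B \<Longrightarrow> cl A \<subseteq> cl B"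
  by (auto simp: flat_closure_def)

lemma cl_eq: "F \<in> L \<Longrightarrow> cl F = F"
  using cl_least subset_cl by blast

lemma rk_cl: "A \<subseteq> E \<Longrightarrow> rk (cl A) = rk A"
  by (simp add: flat_rank_def cl_eq cl_flat)

text \<open>The partition axiom supplies a cover of F containing x; the closure lies strictly above
  F and below that cover, so it equals it.\<close>

lemma flat_cover_cl:
  assumes "F \<in> L" "x \<in> E - F"
  shows "flat_cover F (cl (insert x F))"
proof -
  obtain G where G: "flat_cover F G" "x \<in> G"
    using flats_partition assms by blast
  have "cl (insert x F) \<subseteq> G"
    using G by (intro cl_least) (auto simp: covered_def)
  moreover have "cl (insert x F) \<in> L" "insert x F \<subseteq> cl (insert x F)"
    using assms flat_subset subset_cl by (auto intro!: cl_flat)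
  ultimately have "cl (insert x F) = G"
    using G assms by (auto simp: covered_def)
  with G show ?thesis by simp
qed

lemma flat_cover_eq_cl:
  assumes "flat_cover F G" "x \<in> G - F"
  shows "G = cl (insert x F)"
proof -
  have "F \<in> L" "x \<in> E - F" using assms flat_subset by (auto simp: covered_def)
  then have "flat_cover F (cl (insert x F))" by (rule flat_cover_cl)
  moreover have "cl (insert x F) \<subseteq> G"
    using assms by (intro cl_least) (auto simp: covered_def)
  ultimately show ?thesis using assms unfolding covered_def by blast
qed

lemma flat_cover_path:
  assumes "F \<in> L" "G \<in> L" "F \<subseteq> G"
  shows "flat_cover\<^sup>*\<^sup>* F G"
  using assms
proof (induction "card (G - F)" arbitrary: F rule: less_induct)
  case less
  show ?case
  proof (cases "F = G")
    case False
    then obtain x where x: "x \<in> G - F" using less.prems by auto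
    let ?H = "cl (insert x F)"
    have cov: "flat_cover F ?H" using less.prems x flat_subset by (intro flat_cover_cl) auto
    have H: "?H \<in> L" "F \<subseteq> ?H" using cov by (auto simp: covered_def)
    have sub: "?H \<subseteq> G" using less.prems x by (intro cl_least) auto
    have "G - ?H \<subset> G - F" using x H subset_cl[of "insert x F"] by auto
    moreover have "finite (G - F)" using flat_subset[OF less.prems(2)] finite_ground
      by (meson finite_Diff finite_subset)
    ultimately have "card (G - ?H) < card (G - F)" by (simp add: psubset_card_mono)
    then have "flat_cover\<^sup>*\<^sup>* ?H G" using less.hyps[of ?H] less.prems(2) H(1) sub by blast
    with cov show ?thesis by (rule converse_rtranclp_into_rtranclp)
  qed simp
qed

lemma relpowp_flat_cover_flat:
  "(flat_cover ^^ n) F G \<Longrightarrow> F \<in> L \<Longrightarrow> G \<in> L \<and> F \<subseteq> G"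
proof (induction n arbitrary: G)
  case (Suc n)
  obtain H where H: "(flat_cover ^^ n) F H" "flat_cover H G"
    using relpowp_Suc_E[OF Suc.prems(1)] by metis
  then have "F \<subseteq> H" using Suc.IH Suc.prems(2) by blast
  with H(2) show ?case by (auto simp: covered_def)
qed simp

text \<open>Adjoining an element of the first step of the saturated chain to all members of \<open>C\<close> merges
  at most two of them, by the exchange property.\<close>

lemma chain_card_le:
  assumes "(flat_cover ^^ n) A B"
    and "\<And>c. c \<in> C \<Longrightarrow> c \<in> L \<and> A \<subseteq> c \<and> c \<subseteq> B"
    and "\<And>c d. c \<in> C \<Longrightarrow> d \<in> C \<Longrightarrow> c \<subseteq> d \<or> d \<subseteq> c"
  shows "card C \<le> Suc n"
  using assms
proof (induction n arbitrary: A C)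
  case 0
  then have "C \<subseteq> {A}" by auto
  then show ?case by (simp add: subset_singleton_iff) auto
next
  case (Suc n)
  obtain A1 where A1: "flat_cover A A1" "(flat_cover ^^ n) A1 B"
    using Suc.prems(1) by (rule relpowp_Suc_E2)
  then obtain x where x: "x \<in> A1 - A" by (auto simp: covered_def)
  have A1_eq: "A1 = cl (insert x A)" using A1 x by (rule_tac flat_cover_eq_cl) auto
  have xE: "x \<in> E" using A1 x flat_subset by (auto simp: covered_def)
  have B: "B \<in> L" "A1 \<subseteq> B"
    using relpowp_flat_cover_flat[OF A1(2)] A1(1) by (auto simp: covered_def)
  have xB: "x \<in> B" using B x by blast
  have AL: "A \<in> L" using A1 by (auto simp: covered_def)
  have CL: "c \<in> L" "A \<subseteq> c" "c \<subseteq> B" "c \<subseteq> E" if "c \<in> C" for c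
    using Suc.prems(2)[OF that] flat_subset by auto
  have finC: "finite C" using CL finite_flats by (meson finite_subset subsetI)
  define C0 where "C0 = {c\<in>C. x \<notin> c}"
  define C1 where "C1 = {c\<in>C. x \<in> c}"
  define j where "j = (\<lambda>c. cl (insert x c))"
  have C: "C = C0 \<union> C1" "C0 \<inter> C1 = {}" by (auto simp: C0_def C1_def)
  have fin: "finite C0" "finite C1" using finC C by auto
  have cov: "flat_cover c (j c)" if "c \<in> C0" for c
    unfolding j_def using that CL xE by (intro flat_cover_cl) (auto simp: C0_def)
  have xj: "x \<in> j c" for c using subset_cl[of "insert x c"] by (auto simp: j_def)
  \<comment> \<open>Otherwise d would lie strictly above c and below its cover \<open>j c\<close>,
    so it would equal \<open>j c\<close> and contain x.\<close>
  have between: "d \<subseteq> c" if "c \<in> C0" "d \<in> C0" "d \<subseteq> j c" for c d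
  proof (rule ccontr)
    assume "\<not> d \<subseteq> c"
    then have "c \<subset> d" using Suc.prems(3)[of c d] that C by auto
    then have "d = j c" using cov[OF that(1)] that CL C unfolding covered_def by blast
    then show False using xj that by (auto simp: C0_def)
  qed
  have cj: "c \<subseteq> j c" for c unfolding j_def using subset_cl by blast
  have inj: "inj_on j C0"
  proof (rule inj_onI)
    fix c d assume "c \<in> C0" "d \<in> C0" "j c = j d"
    then show "c = d" using between[of c d] between[of d c] cj[of c] cj[of d] by auto
  qed
  \<comment> \<open>If \<open>j c\<close> is in C1, each d in C0 is comparable with it and cannot
    contain it, because x is not in d. So d lies below \<open>j c\<close>, hence below c: only the
    largest member of C0 can produce an overlap.\<close>
  have overlap: "card (j ` C0 \<inter> C1) \<le> 1"
  proof -
    have "a = b" if a: "a \<in> j ` C0 \<inter> C1" and b: "b \<in> j ` C0 \<inter> C1" for a b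
    proof -
      have *: "d \<subseteq> c" if "c \<in> C0" "j c \<in> C1" "d \<in> C0" for c d
      proof -
        have "d \<subseteq> j c \<or> j c \<subseteq> d" using Suc.prems(3)[of d "j c"] that C by auto
        then have "d \<subseteq> j c" using xj that by (auto simp: C0_def)
        then show ?thesis using between that by blast
      qed
      obtain c d where "c \<in> C0" "d \<in> C0" "a = j c" "b = j d" using a b by auto
      then show ?thesis using *[of c d] *[of d c] a b by auto
    qed
    then show ?thesis using fin by (auto simp: card_le_Suc0_iff_eq)
  qed
  have "card (j ` C0 \<union> C1) \<le> Suc n"
  proof (rule Suc.IH[OF A1(2)])
    show "c \<in> L \<and> A1 \<subseteq> c \<and> c \<subseteq> B" if "c \<in> j ` C0 \<union> C1" for c
      using that
    proof
      assume "c \<in> j ` C0"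
      then obtain d where d: "d \<in> C0" "c = j d" by auto
      have "c \<subseteq> B" using CL[of d] C xB B d(1) unfolding d(2) j_def by (intro cl_least) auto
      moreover have "A1 \<subseteq> c"
        using CL[of d] C d(1) unfolding d(2) A1_eq j_def by (intro cl_mono) auto
      ultimately show ?thesis using d cov[of d] by (auto simp: covered_def)
    next
      assume "c \<in> C1"
      then have c: "c \<in> C" "x \<in> c" by (auto simp: C1_def)
      then have "A1 \<subseteq> c" using CL[OF c(1)] unfolding A1_eq by (intro cl_least) auto
      then show ?thesis using CL[OF c(1)] by auto
    qed
    show "c \<subseteq> d \<or> d \<subseteq> c" if cd: "c \<in> j ` C0 \<union> C1" "d \<in> j ` C0 \<union> C1" for c d
    proof -
      have *: "\<exists>c'\<in>C. c = cl (insert x c')" if c: "c \<in> j ` C0 \<union> C1" for c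
      proof (cases "c \<in> C1")
        case True
        then have "c \<in> C" "insert x c = c" "cl c = c" using CL cl_eq by (auto simp: C1_def)
        then show ?thesis by (intro bexI[of _ c]) simp_all
      qed (use c C in \<open>auto simp: j_def\<close>)
      obtain c' d' where "c' \<in> C" "d' \<in> C" "c = cl (insert x c')" "d = cl (insert x d')"
        using *[OF cd(1)] *[OF cd(2)] by meson
      then show ?thesis using Suc.prems(3)[of c' d'] cl_mono by (metis insert_mono)
    qed
  qed
  moreover have "card (j ` C0 \<union> C1) + card (j ` C0 \<inter> C1) = card C0 + card C1"
    using card_Un_Int[of "j ` C0" C1] fin inj by (simp add: card_image)
  moreover have "card C = card C0 + card C1" using C fin by (metis card_Un_disjoint)
  ultimately show ?case using overlap by linarith
qed

end

section \<open>Gradedness and submodularity of the rank\<close>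

context simple_matroid
begin

text \<open>The members of the saturated chain show that the maximum defining the rank is at least
  n, and \<open>chain_card_le\<close> shows that no chain does better. In particular all saturated
  chains below F have the same length.\<close>

lemma relpowp_rk:
  assumes "(flat_cover ^^ n) {} F"
  shows "rk F = n"
proof -
  have F: "F \<in> L" using relpowp_flat_cover_flat[OF assms empty_flat] by simp
  have ex: "\<exists>C. subset.chain {G\<in>L. G \<subseteq> F} C \<and> card C = Suc n" using assms
  proof (induction n arbitrary: F)
    case 0
    then show ?case using empty_flat
      by (intro exI[of _ "{{}}"]) (auto simp: subset_chain_def)
  next
    case (Suc n)
    obtain G where G: "(flat_cover ^^ n) {} G" "flat_cover G F"
      using relpowp_Suc_E[OF Suc.prems] by metis
    then obtain C where C: "subset.chain {H\<in>L. H \<subseteq> G} C" "card C = Suc n"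
      using Suc by blast
    have "F \<notin> C" using C G by (auto simp: subset_chain_def covered_def)
    moreover have "finite C" using C by (simp add: card_ge_0_finite)
    moreover have "subset.chain {H\<in>L. H \<subseteq> F} (insert F C)"
    proof -
      have F: "F \<in> L" "G \<subseteq> F" using G(2) by (auto simp: covered_def)
      have C': "c \<in> L" "c \<subseteq> F" if "c \<in> C" for c
        using C(1) F(2) that unfolding subset_chain_def by auto
      have "c \<subseteq> d \<or> d \<subseteq> c" if "c \<in> C" "d \<in> C" for c d
        using C(1) that unfolding subset_chain_def by auto
      with C' F(1) show ?thesis
        unfolding subset_chain_insert unfolding subset_chain_def by auto
    qed
    ultimately show ?case using C by (intro exI[of _ "insert F C"]) simp
  qed
  have "card C - 1 \<le> n" if "subset.chain {G\<in>L. G \<subseteq> F} C" for C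
  proof -
    have "card C \<le> Suc n"
      by (rule chain_card_le[OF assms]) (use that in \<open>auto simp: subset_chain_def\<close>)
    then show ?thesis by simp
  qed
  then have "{card C - 1 | C. subset.chain {G\<in>L. G \<subseteq> F} C} \<subseteq> {..n}" by auto
  moreover have "n \<in> {card C - 1 | C. subset.chain {G\<in>L. G \<subseteq> F} C}"
    using ex by (metis (mono_tags, lifting) diff_Suc_1 mem_Collect_eq)
  ultimately have "Max {card C - 1 | C. subset.chain {G\<in>L. G \<subseteq> F} C} = n"
    by (meson Max_eqI atMost_iff finite_atMost finite_subset subsetD)
  then show ?thesis by (simp add: flat_rank_def cl_eq[OF F])
qed

lemma rk_empty [simp]: "rk {} = 0"
  using relpowp_rk[of 0] by simp

lemma rk_cover:
  assumes "flat_cover F G"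
  shows "rk G = Suc (rk F)"
proof -
  have "flat_cover\<^sup>*\<^sup>* {} F"
    using assms empty_flat by (intro flat_cover_path) (auto simp: covered_def)
  then obtain n where n: "(flat_cover ^^ n) {} F" by (meson rtranclp_imp_relpowp)
  then have "(flat_cover ^^ Suc n) {} G" using assms by auto
  with n show ?thesis using relpowp_rk by blast
qed

lemma rk_mono:
  assumes "F \<in> L" "G \<in> L" "F \<subseteq> G"
  shows "rk F \<le> rk G"
  using flat_cover_path[OF assms] by (induction rule: rtranclp_induct) (auto dest: rk_cover)

lemma rk_strict_mono:
  assumes "F \<in> L" "G \<in> L" "F \<subset> G"
  shows "rk F < rk G"
proof -
  obtain H where H: "flat_cover F H" "flat_cover\<^sup>*\<^sup>* H G"
    using flat_cover_path[of F G] assms by (metis converse_rtranclpE psubset_eq)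
  from H(2) have "rk H \<le> rk G"
    by (induction rule: rtranclp_induct) (auto dest: rk_cover)
  with H show ?thesis by (auto dest: rk_cover)
qed

lemma rk_eq_imp_eq: "F \<in> L \<Longrightarrow> G \<in> L \<Longrightarrow> F \<subseteq> G \<Longrightarrow> rk G \<le> rk F \<Longrightarrow> F = G"
  using rk_strict_mono[of F G] by auto

lemma flat_coverI:
  assumes "F \<in> L" "G \<in> L" "F \<subseteq> G" "rk G = Suc (rk F)"
  shows "flat_cover F G"
  unfolding covered_def
proof (intro conjI ballI impI)
  fix H assume H: "H \<in> L" "F \<subseteq> H \<and> H \<subseteq> G"
  then have "rk F \<le> rk H" "rk H \<le> rk G"
    using rk_mono[OF assms(1) H(1)] rk_mono[OF H(1) assms(2)] by auto
  with assms(4) consider "rk H \<le> rk F" | "rk G \<le> rk H" by linarith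
  then show "H = F \<or> H = G"
  proof cases
    case 1
    then show ?thesis using rk_eq_imp_eq[OF assms(1) H(1)] H(2) by simp
  next
    case 2
    then show ?thesis using rk_eq_imp_eq[OF H(1) assms(2)] H(2) by simp
  qed
qed (use assms in auto)

text \<open>Submodularity: joining with A cannot enlarge a rank difference. Along a saturated chain
  from F to G each step adjoins one point x up to closure, and this raises the rank of the join with
  A by at most one.\<close>

lemma rk_Un_mono_le:
  assumes "A \<subseteq> E" "F \<in> L" "G \<in> L" "F \<subseteq> G"
  shows "rk (A \<union> G) + rk F \<le> rk (A \<union> F) + rk G"
  using flat_cover_path[OF assms(2-4)]
proof (induction rule: rtranclp_induct)
  case (step G H)
  then obtain x where x: "x \<in> H - G" by (auto simp: covered_def)
  have HE: "G \<in> L" "H \<in> L" "H \<subseteq> E" "G \<subseteq> E" "G \<subseteq> H" using step flat_subset by (auto simp: covered_def)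
  have H: "H = cl (insert x G)" using step x by (intro flat_cover_eq_cl) auto
  let ?J = "cl (A \<union> G)"
  have J: "?J \<in> L" using assms HE by (intro cl_flat) auto
  have xJ: "cl (insert x ?J) \<in> L" using J x HE flat_subset by (intro cl_flat) auto
  have "H \<subseteq> cl (insert x ?J)" unfolding H
    using subset_cl[of "A \<union> G"] by (intro cl_mono) auto
  then have "A \<union> H \<subseteq> cl (insert x ?J)"
    using subset_cl[of "A \<union> G"] subset_cl[of "insert x ?J"] by auto
  then have "cl (A \<union> H) \<subseteq> cl (insert x ?J)" using xJ by (intro cl_least)
  moreover have "cl (A \<union> H) \<in> L" using assms HE by (intro cl_flat) auto
  ultimately have "rk (cl (A \<union> H)) \<le> rk (cl (insert x ?J))" using xJ rk_mono by blast
  also have "\<dots> \<le> Suc (rk ?J)"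
  proof (cases "x \<in> ?J")
    case True
    then show ?thesis using J cl_eq by (simp add: insert_absorb)
  next
    case False
    then show ?thesis using J x HE rk_cover[OF flat_cover_cl[of ?J x]] by auto
  qed
  finally have "rk (A \<union> H) \<le> Suc (rk (A \<union> G))"
    using assms HE by (simp add: rk_cl)
  moreover have "rk H = Suc (rk G)" using step rk_cover by blast
  ultimately show ?case using step by simp
qed simp

end

section \<open>The defect of a lattice map\<close>

locale covering_map = M1: simple_matroid E1 L1 + M2: simple_matroid E2 L2
  for E1 :: "'a set" and L1 :: "'a set set" and E2 :: "'b set" and L2 :: "'b set set" +
  fixes f :: "'a set \<Rightarrow> 'b set"
  assumes covering: "covering_lattice_map L1 L2 f"
begin

abbreviation p1 :: "('a + 'b) set \<Rightarrow> 'a set" where "p1 F \<equiv> Inl -` F"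
abbreviation p2 :: "('a + 'b) set \<Rightarrow> 'b set" where "p2 F \<equiv> Inr -` F"

abbreviation D :: "('a + 'b) set set" where "D \<equiv> direct_sum L1 L2"

definition join :: "('a + 'b) set \<Rightarrow> 'b set" where
  "join F = flat_closure L2 (f (p1 F) \<union> p2 F)"

definition rank :: "('a + 'b) set \<Rightarrow> nat" where
  "rank F = flat_rank L1 (p1 F) + flat_rank L2 (p2 F)"

definition defect :: "('a + 'b) set \<Rightarrow> nat" where
  "defect F = rank F - flat_rank L2 (join F)"

lemma f_flat: "X \<in> L1 \<Longrightarrow> f X \<in> L2"
  using covering by (auto simp: covering_lattice_map_def weak_lattice_map_def)

lemma f_mono: "X \<in> L1 \<Longrightarrow> X' \<in> L1 \<Longrightarrow> X \<subseteq> X' \<Longrightarrow> f X \<subseteq> f X'"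
  using covering by (auto simp: covering_lattice_map_def weak_lattice_map_def)

lemma f_rank: "X \<in> L1 \<Longrightarrow> flat_rank L2 (f X) \<le> flat_rank L1 X"
  using covering by (auto simp: covering_lattice_map_def weak_lattice_map_def)

text \<open>The place where the covering condition itself enters: on each step of a saturated chain
  the image gains at most one rank while the argument gains exactly one.\<close>

lemma f_rank_diff:
  assumes "X \<in> L1" "X' \<in> L1" "X \<subseteq> X'"
  shows "flat_rank L2 (f X') + flat_rank L1 X \<le> flat_rank L2 (f X) + flat_rank L1 X'"
  using M1.flat_cover_path[OF assms]
proof (induction rule: rtranclp_induct)
  case (step Y Z)
  have "covered L2 (\<subseteq>) (f Y) (f Z) \<or> f Y = f Z"
    using covering step(2) by (auto simp: covering_lattice_map_def)
  then have "flat_rank L2 (f Z) \<le> Suc (flat_rank L2 (f Y))"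
    using M2.rk_cover by fastforce
  then show ?case using step M1.rk_cover[OF step(2)] by simp
qed simp

lemma Plus_projections [simp]: "p1 F <+> p2 F = F"
proof (intro set_eqI)
  show "x \<in> p1 F <+> p2 F \<longleftrightarrow> x \<in> F" for x by (cases x) auto
qed

lemma p1_Plus [simp]: "p1 (X <+> Y) = X"
  by auto

lemma p2_Plus [simp]: "p2 (X <+> Y) = Y"
  by auto

lemma inj_Plus: "inj_on (\<lambda>X :: 'a set. X <+> (Y :: 'b set)) A"
  by (rule inj_on_inverseI[where g = p1]) simp

lemma D_iff: "F \<in> D \<longleftrightarrow> p1 F \<in> L1 \<and> p2 F \<in> L2"
proof
  assume "p1 F \<in> L1 \<and> p2 F \<in> L2"
  then have "p1 F <+> p2 F \<in> D" unfolding direct_sum_def by blast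
  then show "F \<in> D" by simp
qed (auto simp: direct_sum_def)

lemma D_p1: "F \<in> D \<Longrightarrow> p1 F \<in> L1"
  and D_p2: "F \<in> D \<Longrightarrow> p2 F \<in> L2"
  by (simp_all add: D_iff)

lemma subset_iff_projections: "F \<subseteq> G \<longleftrightarrow> p1 F \<subseteq> p1 G \<and> p2 F \<subseteq> p2 G"
proof
  assume *: "p1 F \<subseteq> p1 G \<and> p2 F \<subseteq> p2 G"
  show "F \<subseteq> G"
  proof
    show "x \<in> G" if "x \<in> F" for x using that * by (cases x) auto
  qed
qed auto

lemma D_subset: "F \<in> D \<Longrightarrow> F \<subseteq> E1 <+> E2"
  using D_p1 D_p2 M1.flat_subset M2.flat_subset by (simp add: subset_iff_projections)

lemma finite_D: "finite D"
proof -
  have "D = (\<lambda>(X, Y). X <+> Y) ` (L1 \<times> L2)" by (auto simp: direct_sum_def)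
  then show ?thesis using M1.finite_flats M2.finite_flats by simp
qed

lemma top_D: "E1 <+> E2 \<in> D"
  by (simp add: D_iff M1.ground_flat M2.ground_flat)

lemma finite_member_D: "F \<in> D \<Longrightarrow> finite F"
  using D_subset M1.finite_ground M2.finite_ground by (meson finite_Plus finite_subset)

lemma join_arg_subset: "F \<in> D \<Longrightarrow> f (p1 F) \<union> p2 F \<subseteq> E2"
  using D_p1 D_p2 f_flat M2.flat_subset by auto

lemma join_flat: "F \<in> D \<Longrightarrow> join F \<in> L2"
  unfolding join_def using join_arg_subset by (rule M2.cl_flat)

lemma subset_join: "f (p1 F) \<subseteq> join F" "p2 F \<subseteq> join F"
  using M2.subset_cl[of "f (p1 F) \<union> p2 F"] by (auto simp: join_def)

lemma join_mono: "F \<in> D \<Longrightarrow> G \<in> D \<Longrightarrow> F \<subseteq> G \<Longrightarrow> join F \<subseteq> join G"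
  unfolding join_def using f_mono[of "p1 F" "p1 G"] D_p1
  by (intro M2.cl_mono) (auto simp: subset_iff_projections)

lemma join_eq:
  assumes "F \<in> D" "f (p1 F) \<subseteq> p2 F"
  shows "join F = p2 F"
proof -
  have "f (p1 F) \<union> p2 F = p2 F" using assms by auto
  then show ?thesis using M2.cl_eq D_p2 assms by (simp add: join_def)
qed

lemma rk_join: "F \<in> D \<Longrightarrow> flat_rank L2 (join F) = flat_rank L2 (f (p1 F) \<union> p2 F)"
  unfolding join_def using join_arg_subset by (rule M2.rk_cl)

text \<open>Shows that the truncated subtraction in \<open>defect\<close> is a true one: the rank of
  the join is at most rk (f F1) + rk F2 by submodularity, and f does not raise ranks.\<close>

lemma defect_add:
  assumes "F \<in> D"
  shows "defect F + flat_rank L2 (join F) = rank F"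
proof -
  have "flat_rank L2 (f (p1 F) \<union> p2 F) + flat_rank L2 {} \<le> flat_rank L2 (f (p1 F) \<union> {}) + flat_rank L2 (p2 F)"
    using assms D_p1 D_p2 f_flat M2.flat_subset M2.empty_flat
    by (intro M2.rk_Un_mono_le) auto
  then have "flat_rank L2 (join F) \<le> rank F"
    using f_rank[of "p1 F"] assms by (simp add: rk_join rank_def D_iff)
  then show ?thesis by (simp add: defect_def)
qed

text \<open>The rank of the join may not grow faster than \<open>rank\<close>. Enlarging the second
  component is controlled by submodularity; enlarging the first by submodularity, which passes to
  the images under f, followed by \<open>f_rank_diff\<close>.\<close>

lemma defect_mono:
  assumes "F \<in> D" "G \<in> D" "F \<subseteq> G"
  shows "defect F \<le> defect G"
proof -
  have p: "p1 F \<in> L1" "p1 G \<in> L1" "p2 F \<in> L2" "p2 G \<in> L2" "p1 F \<subseteq> p1 G" "p2 F \<subseteq> p2 G"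
    using assms by (auto simp: D_iff)
  have s: "f (p1 F) \<subseteq> E2" "f (p1 G) \<subseteq> E2" "p2 G \<subseteq> E2" using p f_flat M2.flat_subset by auto
  have "flat_rank L2 (p2 G \<union> f (p1 G)) + flat_rank L2 (f (p1 F)) \<le>
      flat_rank L2 (p2 G \<union> f (p1 F)) + flat_rank L2 (f (p1 G))"
    using p s f_flat f_mono by (intro M2.rk_Un_mono_le) auto
  moreover have "flat_rank L2 (f (p1 F) \<union> p2 G) + flat_rank L2 (p2 F) \<le>
      flat_rank L2 (f (p1 F) \<union> p2 F) + flat_rank L2 (p2 G)"
    using p s by (intro M2.rk_Un_mono_le) auto
  moreover have "flat_rank L2 (f (p1 G)) + flat_rank L1 (p1 F) \<le> flat_rank L2 (f (p1 F)) + flat_rank L1 (p1 G)"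
    using p by (intro f_rank_diff) auto
  ultimately have "flat_rank L2 (join G) + rank F \<le> flat_rank L2 (join F) + rank G"
    using assms by (simp add: rk_join rank_def Un_commute)
  then show ?thesis using defect_add[OF assms(1)] defect_add[OF assms(2)] by linarith
qed

lemma defect_le: "F \<in> D \<Longrightarrow> defect F \<le> flat_rank L1 (p1 F)"
  using defect_add[of F] M2.rk_mono[of "p2 F" "join F"] D_p2 join_flat subset_join(2)
  by (fastforce simp: rank_def)

text \<open>Equality in \<open>defect_le\<close> means that the join has the rank of the second
  component and so coincides with it. Thus the graph condition f X \<subseteq> Y is the extremal
  case of the defect.\<close>

lemma defect_eq_iff:
  assumes "F \<in> D"
  shows "defect F = flat_rank L1 (p1 F) \<longleftrightarrow> f (p1 F) \<subseteq> p2 F"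
proof
  assume "defect F = flat_rank L1 (p1 F)"
  then have "flat_rank L2 (join F) = flat_rank L2 (p2 F)"
    using defect_add[OF assms] by (simp add: rank_def)
  then have "p2 F = join F"
    using assms join_flat D_p2 subset_join(2) by (intro M2.rk_eq_imp_eq) auto
  then show "f (p1 F) \<subseteq> p2 F" using subset_join(1) by metis
next
  assume "f (p1 F) \<subseteq> p2 F"
  then show "defect F = flat_rank L1 (p1 F)"
    using defect_add[OF assms] join_eq[OF assms] by (simp add: rank_def)
qed

lemma rank_eq_imp_eq:
  assumes "F \<in> D" "G \<in> D" "F \<subseteq> G" "rank G \<le> rank F"
  shows "F = G"
proof -
  have p: "p1 F \<in> L1" "p1 G \<in> L1" "p2 F \<in> L2" "p2 G \<in> L2" "p1 F \<subseteq> p1 G" "p2 F \<subseteq> p2 G"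
    using assms by (auto simp: D_iff)
  then have "flat_rank L1 (p1 F) \<le> flat_rank L1 (p1 G)" "flat_rank L2 (p2 F) \<le> flat_rank L2 (p2 G)"
    using M1.rk_mono M2.rk_mono by auto
  then have "p1 F = p1 G" "p2 F = p2 G"
    using p assms(4) M1.rk_eq_imp_eq[of "p1 F" "p1 G"] M2.rk_eq_imp_eq[of "p2 F" "p2 G"]
    by (auto simp: rank_def)
  then show ?thesis using Plus_projections by metis
qed

text \<open>Stands in for the partition axiom of the direct sum: x lies in one of the two summands,
  and K is obtained by closing that component under the new element.\<close>

lemma minimal_extension:
  assumes "F \<in> D" "x \<in> E1 <+> E2" "x \<notin> F"
  obtains K where "K \<in> D" "F \<subseteq> K" "x \<in> K" "rank K = Suc (rank F)"
    "\<And>H. H \<in> D \<Longrightarrow> F \<subseteq> H \<Longrightarrow> x \<in> H \<Longrightarrow> K \<subseteq> H"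
proof (cases x)
  case (Inl a)
  let ?X = "flat_closure L1 (insert a (p1 F))"
  have a: "a \<in> E1 - p1 F" using assms Inl by auto
  have cov: "covered L1 (\<subseteq>) (p1 F) ?X" using a assms D_p1 by (intro M1.flat_cover_cl) auto
  have sub: "insert a (p1 F) \<subseteq> ?X" by (rule M1.subset_cl)
  show thesis
  proof (rule that[of "?X <+> p2 F"])
    show "?X <+> p2 F \<in> D" using cov assms by (auto simp: D_iff covered_def)
    show "F \<subseteq> ?X <+> p2 F" using sub by (auto simp: subset_iff_projections)
    show "x \<in> ?X <+> p2 F" using sub Inl by auto
    show "rank (?X <+> p2 F) = Suc (rank F)" using M1.rk_cover[OF cov] by (simp add: rank_def)
    show "?X <+> p2 F \<subseteq> H" if "H \<in> D" "F \<subseteq> H" "x \<in> H" for H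
      using that Inl M1.cl_least[of "p1 H" "insert a (p1 F)"] D_p1
      by (auto simp: subset_iff_projections)
  qed
next
  case (Inr b)
  let ?Y = "flat_closure L2 (insert b (p2 F))"
  have b: "b \<in> E2 - p2 F" using assms Inr by auto
  have cov: "covered L2 (\<subseteq>) (p2 F) ?Y" using b assms D_p2 by (intro M2.flat_cover_cl) auto
  have sub: "insert b (p2 F) \<subseteq> ?Y" by (rule M2.subset_cl)
  show thesis
  proof (rule that[of "p1 F <+> ?Y"])
    show "p1 F <+> ?Y \<in> D" using cov assms by (auto simp: D_iff covered_def)
    show "F \<subseteq> p1 F <+> ?Y" using sub by (auto simp: subset_iff_projections)
    show "x \<in> p1 F <+> ?Y" using sub Inr by auto
    show "rank (p1 F <+> ?Y) = Suc (rank F)" using M2.rk_cover[OF cov] by (simp add: rank_def)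
    show "p1 F <+> ?Y \<subseteq> H" if "H \<in> D" "F \<subseteq> H" "x \<in> H" for H
      using that Inr M2.cl_least[of "p2 H" "insert b (p2 F)"] D_p2
      by (auto simp: subset_iff_projections)
  qed
qed

section \<open>The intermediate pairs\<close>

text \<open>On the vertices of the pair with threshold \<open>m\<close> this is the length of the flags from \<open>\<emptyset>\<close>: flats
  of defect at most \<open>m\<close> keep their rank in the product, those of larger defect are lowered.\<close>

definition grade :: "nat \<Rightarrow> ('a + 'b) set \<Rightarrow> nat" where
  "grade m F = min (defect F) m + flat_rank L2 (join F)"

text \<open>These sets shrink as m decreases: for m = rk M1 all flats of the sum qualify, for m = 0
  exactly those with f X \<subseteq> Y.\<close>

definition admissible :: "nat \<Rightarrow> ('a + 'b) set set" where
  "admissible m = {F \<in> D. m \<le> defect F \<longrightarrow> f (p1 F) \<subseteq> p2 F}"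

definition low :: "'a set \<Rightarrow> 'a set \<Rightarrow> 'b set \<Rightarrow> 'a set set" where
  "low X1 X2 Y = {F\<in>L1. X1 \<subseteq> F \<and> F \<subseteq> X2 \<and> f F \<subseteq> Y}"

definition edge_wt :: "nat \<Rightarrow> ('a + 'b) set \<Rightarrow> ('a + 'b) set \<Rightarrow> int" where
  "edge_wt m F G = (if m \<le> defect F then eta (low (p1 F) (p1 G) (p2 F)) (p1 F) else 1)"

text \<open>Formulated on all admissible flats, independently of which vertices survive the
  deletions; the covers of an actual pair are the edges between its vertices.\<close>

definition edge :: "nat \<Rightarrow> ('a + 'b) set \<Rightarrow> ('a + 'b) set \<Rightarrow> bool" where
  "edge m F G \<longleftrightarrow> F \<in> admissible m \<and> G \<in> admissible m \<and> F \<subseteq> G \<and>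
     grade m G = Suc (grade m F) \<and> edge_wt m F G \<noteq> 0"

lemma admissible_D: "F \<in> admissible m \<Longrightarrow> F \<in> D"
  by (simp add: admissible_def)

lemma admissible_Suc: "admissible m \<subseteq> admissible (Suc m)"
  by (auto simp: admissible_def)

lemma admissible_join: "F \<in> admissible m \<Longrightarrow> m \<le> defect F \<Longrightarrow> join F = p2 F"
  by (simp add: admissible_def join_eq)

lemma grade_eq_rank: "F \<in> D \<Longrightarrow> defect F \<le> m \<Longrightarrow> grade m F = rank F"
  using defect_add by (simp add: grade_def min_absorb1)

lemma finite_low: "finite (low X1 X2 Y)"
  using M1.finite_flats by (simp add: low_def)

text \<open>Each \<open>low F X2 Y\<close> is the part of \<open>low X1 X2 Y\<close> above F, so by
  \<open>eta_upset\<close> all summands are eta values of one poset and \<open>sum_eta\<close>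
  applies.\<close>

lemma sum_eta_low:
  assumes "X \<in> low X1 X2 Y"
  shows "(\<Sum>F\<in>{F \<in> low X1 X2 Y. X \<subseteq> F}. eta (low F X2 Y) F) = 1"
proof -
  have "low F X2 Y = {G \<in> low X1 X2 Y. F \<subseteq> G}" if "F \<in> low X1 X2 Y" for F
    using that by (auto simp: low_def)
  then have "eta (low F X2 Y) F = eta (low X1 X2 Y) F" if "F \<in> low X1 X2 Y" for F
    using that eta_upset[OF finite_low, of X1 X2 Y F] by simp
  then have "(\<Sum>F\<in>{F \<in> low X1 X2 Y. X \<subseteq> F}. eta (low F X2 Y) F) =
      (\<Sum>F\<in>{F \<in> low X1 X2 Y. X \<subseteq> F}. eta (low X1 X2 Y) F)"
    by (intro sum.cong) auto
  then show ?thesis using sum_eta[OF finite_low assms] by simp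
qed

text \<open>By monotonicity of f the poset is empty. This is what removes edges whose lower end
  violates the graph condition.\<close>

lemma eta_low_eq_0: "\<not> f X1 \<subseteq> Y \<Longrightarrow> X1 \<in> L1 \<Longrightarrow> eta (low X1 X2 Y) X1 = 0"
  using f_mono by (fastforce simp: eta_def low_def intro!: sum.neutral)

lemma eta_low_refl: "f X \<subseteq> Y \<Longrightarrow> X \<in> L1 \<Longrightarrow> eta (low X X Y) X = 1"
proof -
  assume "f X \<subseteq> Y" "X \<in> L1"
  then have "low X X Y = {X}" by (auto simp: low_def)
  moreover have "{b. b = X \<and> X \<subseteq> b} = {X}" by auto
  ultimately show ?thesis by (simp add: eta_def)
qed

end

text \<open>A segment of length two of the pair with threshold \<open>Suc m\<close> along which the next rational
  function changes its value.\<close>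

locale critical_segment = covering_map +
  fixes m :: nat and F G :: "('a + 'b) set"
  assumes F: "F \<in> admissible (Suc m)" and G: "G \<in> admissible (Suc m)"
    and FG: "F \<subseteq> G" and defect_F: "defect F \<le> m" and defect_G: "m < defect G"
    and grade_FG: "grade m G = Suc (grade m F)"
begin

lemma F_D: "F \<in> D" and G_D: "G \<in> D"
  using F G admissible_D by auto

text \<open>Candidates for the middle of the segment. Those with weight 0 towards G are kept,
  although they are not joined to G by an edge: they add nothing to the sums and make the index sets
  uniform.\<close>

definition mids :: "('a + 'b) set set" where
  "mids = {H \<in> admissible (Suc m). F \<subseteq> H \<and> H \<subseteq> G \<and> grade (Suc m) H = Suc (grade (Suc m) F)}"

abbreviation P :: "'a set set" where
  "P \<equiv> low (p1 F) (p1 G) (join F)"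

lemma finite_mids: "finite mids"
  using finite_D by (rule finite_subset[rotated]) (auto simp: mids_def admissible_def)

lemma grade_F: "grade (Suc m) F = rank F" "grade m F = rank F"
  using F_D defect_F by (simp_all add: grade_eq_rank)

text \<open>Replacing the threshold \<open>Suc m\<close> by m lowers the grade of G by one and keeps
  that of F, so a segment of length two turns into a single step.\<close>

lemma grade_G: "grade (Suc m) G = Suc (Suc (grade (Suc m) F))"
  using grade_FG grade_F defect_G by (simp add: grade_def)

lemma bottom_P: "p1 F \<in> P"
  using FG F_D subset_join(1) by (auto simp: low_def D_iff)

text \<open>For H of defect above m the first summand of the grade is \<open>Suc m\<close>, at least
  one more than that of F. Since the grade rises by one only, F has defect m and the join does not
  change; admissibility of H then makes its second component equal to \<open>join F\<close>, while
  the first ranges over the flats in \<open>P\<close> of rank above m.\<close>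

lemma mids_high:
  "{H \<in> mids. m < defect H} =
     (if defect F = m then (\<lambda>X. X <+> join F) ` {X \<in> P. m < flat_rank L1 X} else {})"
  (is "?A = ?B")
proof
  show "?A \<subseteq> ?B"
  proof
    fix H assume "H \<in> ?A"
    then have H: "H \<in> admissible (Suc m)" "F \<subseteq> H" "H \<subseteq> G" "m < defect H"
      "grade (Suc m) H = Suc (grade (Suc m) F)" by (auto simp: mids_def)
    have HD: "H \<in> D" using H admissible_D by auto
    have jn: "join F \<subseteq> join H" using H HD F_D by (intro join_mono) auto
    have "flat_rank L2 (join F) \<le> flat_rank L2 (join H)"
      using jn F_D HD join_flat by (intro M2.rk_mono) auto
    moreover have "Suc m + flat_rank L2 (join H) = Suc (defect F + flat_rank L2 (join F))"
      using H grade_F defect_add[OF F_D] by (simp add: grade_def min_absorb2)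
    ultimately have eq: "defect F = m" "flat_rank L2 (join H) \<le> flat_rank L2 (join F)"
      using defect_F by auto
    have "join F = join H" using jn eq F_D HD join_flat by (intro M2.rk_eq_imp_eq) auto
    then have p2H: "p2 H = join F" "f (p1 H) \<subseteq> join F"
      using admissible_join[OF H(1)] H(4) subset_join(1)[of H] by auto
    then have "p1 H \<in> P" using H HD by (auto simp: low_def D_iff)
    moreover have "m < flat_rank L1 (p1 H)" using H(4) defect_le[OF HD] by simp
    moreover have "H = p1 H <+> join F" using p2H(1) Plus_projections[of H] by simp
    ultimately show "H \<in> ?B" using eq(1) by auto
  qed
  show "?B \<subseteq> ?A"
  proof (cases "defect F = m")
    case True
    have "X <+> join F \<in> ?A" if X: "X \<in> P" "m < flat_rank L1 X" for X
    proof -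
      let ?H = "X <+> join F"
      have HD: "?H \<in> D" using X join_flat[OF F_D] by (auto simp: D_iff low_def)
      have f: "f (p1 ?H) \<subseteq> p2 ?H" using X by (simp add: low_def)
      then have d: "defect ?H = flat_rank L1 X" using defect_eq_iff[OF HD] by simp
      have "F \<subseteq> ?H" using X subset_join(2) by (auto simp: subset_iff_projections low_def)
      \<comment> \<open>G has defect above m, so by admissibility its join is its second
        component.\<close>
      moreover have "join F \<subseteq> p2 G"
        using join_mono[OF F_D G_D FG] admissible_join[OF G] defect_G by simp
      then have "?H \<subseteq> G" using X by (auto simp: subset_iff_projections low_def)
      moreover have "grade (Suc m) ?H = Suc (grade (Suc m) F)"
        using d X(2) join_eq[OF HD f] True by (simp add: grade_def)
      ultimately show ?thesis using HD f d X(2) by (simp add: mids_def admissible_def)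
    qed
    then show ?thesis using True by auto
  qed auto
qed

lemma edge_wt_from_F: "edge_wt (Suc m) F H = 1"
  using defect_F by (simp add: edge_wt_def)

lemma edge_wt_high:
  assumes "X \<in> P" "m < flat_rank L1 X"
  shows "edge_wt (Suc m) (X <+> join F) G = eta (low X (p1 G) (join F)) X"
proof -
  have HD: "X <+> join F \<in> D" using assms join_flat[OF F_D] by (auto simp: D_iff low_def)
  have "f X \<subseteq> join F" using assms by (simp add: low_def)
  then have "defect (X <+> join F) = flat_rank L1 X" using defect_eq_iff[OF HD] by simp
  then show ?thesis using assms(2) by (simp add: edge_wt_def)
qed

text \<open>Up to sign this is the first term of the segment weight. Suppose F has defect m. If F
  satisfies the graph condition, its first component has rank m, the sum runs over \<open>P\<close>
  without its bottom, and the missing eta value is the new weight. If not, the sum runs over all of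
  \<open>P\<close> and the new weight is 0. For smaller defect there are no such H and the new
  weight is 1.\<close>

lemma sum_mids_high:
  "(\<Sum>H\<in>{H \<in> mids. m < defect H}. edge_wt (Suc m) H G) = 1 - edge_wt m F G"
proof (cases "defect F = m")
  case True
  have "(\<Sum>H\<in>{H \<in> mids. m < defect H}. edge_wt (Suc m) H G) =
      (\<Sum>X\<in>{X \<in> P. m < flat_rank L1 X}. edge_wt (Suc m) (X <+> join F) G)"
    unfolding mids_high using True by (simp add: sum.reindex[OF inj_Plus])
  also have "\<dots> = (\<Sum>X\<in>{X \<in> P. m < flat_rank L1 X}. eta (low X (p1 G) (join F)) X)"
    by (intro sum.cong) (auto simp: edge_wt_high)
  also have "\<dots> = 1 - edge_wt m F G"
  proof (cases "f (p1 F) \<subseteq> p2 F")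
    case f: True
    then have rk: "flat_rank L1 (p1 F) = m" "join F = p2 F"
      using defect_eq_iff[OF F_D] True join_eq[OF F_D] by auto
    have "{X \<in> P. m < flat_rank L1 X} = {X \<in> P. p1 F \<subseteq> X} - {p1 F}"
      using M1.rk_strict_mono[of "p1 F"] D_p1[OF F_D] rk(1) by (auto simp: low_def psubset_eq)
    then show ?thesis
      using sum_eta_low[OF bottom_P] bottom_P finite_low True rk(2)
      by (simp add: sum_diff1 edge_wt_def)
  next
    case f: False
    then have "m < flat_rank L1 (p1 F)"
      using defect_eq_iff[OF F_D] defect_le[OF F_D] True by linarith
    moreover have "p1 F \<subseteq> X \<and> flat_rank L1 (p1 F) \<le> flat_rank L1 X" if "X \<in> P" for X
      using M1.rk_mono[of "p1 F" X] D_p1[OF F_D] that by (auto simp: low_def)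
    ultimately have "{X \<in> P. m < flat_rank L1 X} = {X \<in> P. p1 F \<subseteq> X}"
      by (intro Collect_cong) (metis order.strict_trans2)
    moreover have "edge_wt m F G = 0"
      using f True eta_low_eq_0 D_p1[OF F_D] by (simp add: edge_wt_def)
    ultimately show ?thesis using sum_eta_low[OF bottom_P] by simp
  qed
  finally show ?thesis .
next
  case False
  then have "edge_wt m F G = 1" using defect_F by (simp add: edge_wt_def)
  then show ?thesis unfolding mids_high using False by simp
qed

text \<open>The flats covering \<open>F\<close> in the product partition \<open>G - F\<close>; a cover of too large defect is
  replaced by the flats \<open>X <+> join F\<close> above it, whose weights add up to one.\<close>

lemma sum_mids_containing:
  assumes x: "x \<in> G - F"
  shows "(\<Sum>H\<in>{H \<in> mids. x \<in> H}. edge_wt (Suc m) H G) = 1"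
proof -
  have "x \<in> E1 <+> E2" using x D_subset[OF G_D] by auto
  then obtain K where K: "K \<in> D" "F \<subseteq> K" "x \<in> K" "rank K = Suc (rank F)"
    and least: "\<And>H. H \<in> D \<Longrightarrow> F \<subseteq> H \<Longrightarrow> x \<in> H \<Longrightarrow> K \<subseteq> H"
    using minimal_extension[OF F_D, of x] x by blast
  have KG: "K \<subseteq> G" using least[OF G_D FG] x by auto
  have jn: "join F \<subseteq> join K" using K F_D by (intro join_mono) auto
  have rk_jn: "flat_rank L2 (join F) \<le> flat_rank L2 (join K)"
    using jn F_D K join_flat by (intro M2.rk_mono) auto
  have mids: "H \<in> D" "K \<subseteq> H" if "H \<in> mids" "x \<in> H" for H
    using that least[of H] admissible_D by (auto simp: mids_def)
  show ?thesis
  proof (cases "defect K \<le> m")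
    case True
    have "K \<in> mids"
      using K KG True grade_F by (simp add: mids_def admissible_def grade_eq_rank)
    \<comment> \<open>A middle of low defect has the rank of K and contains it. One of high defect
      would force \<open>join K = join F\<close> and thereby defect \<open>Suc m\<close> for K, a
      contradiction.\<close>
    moreover have "H = K" if H: "H \<in> mids" "x \<in> H" for H
    proof (cases "defect H \<le> m")
      case True
      then have "rank H = rank K"
        using H mids[OF H] K(4) grade_F by (simp add: mids_def grade_eq_rank)
      then show ?thesis using rank_eq_imp_eq[of K H] mids[OF H] K(1) by simp
    next
      case False
      then have "H \<in> {H \<in> mids. m < defect H}" using H by simp
      then have d: "defect F = m" and "\<exists>X\<in>P. H = X <+> join F"
        unfolding mids_high by (auto split: if_splits)
      then have "join H = join F"
        using mids[OF H] join_eq[of H] by (auto simp: low_def)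
      then have "join K = join F" using join_mono[OF K(1) mids[OF H]] jn by simp
      then show ?thesis
        using defect_add[OF F_D] defect_add[OF K(1)] K(4) d \<open>defect K \<le> m\<close> by simp
    qed
    ultimately have "{H \<in> mids. x \<in> H} = {K}" using K(3) by blast
    then show ?thesis using True by (simp add: edge_wt_def)
  next
    case False
    then have "defect F = m" and "flat_rank L2 (join K) \<le> flat_rank L2 (join F)"
      using defect_add[OF F_D] defect_add[OF K(1)] K(4) rk_jn defect_F by linarith+
    then have d: "defect F = m" and jK: "join K = join F"
      using jn M2.rk_eq_imp_eq[of "join F" "join K"] join_flat F_D K(1) by auto
    have p1K: "p1 K \<in> P"
      using K KG subset_join(1)[of K] unfolding jK by (auto simp: low_def D_iff)
    \<comment> \<open>From left to right K is least among the flats containing F and x. Conversely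
      the second component of K lies in \<open>join F\<close>, and the rank of X is at least the
      defect of K.\<close>
    have key: "m < flat_rank L1 X \<and> x \<in> X <+> join F \<longleftrightarrow> p1 K \<subseteq> X" if X: "X \<in> P" for X
    proof
      assume *: "m < flat_rank L1 X \<and> x \<in> X <+> join F"
      have "X <+> join F \<in> D" using X join_flat[OF F_D] by (auto simp: D_iff low_def)
      moreover have "F \<subseteq> X <+> join F"
        using X subset_join(2) by (auto simp: subset_iff_projections low_def)
      ultimately have "K \<subseteq> X <+> join F" using * least by blast
      then show "p1 K \<subseteq> X" by (simp add: subset_iff_projections)
    next
      assume *: "p1 K \<subseteq> X"
      have "p2 K \<subseteq> join F" using subset_join(2)[of K] jK by simp
      then have "K \<subseteq> X <+> join F" using * by (simp add: subset_iff_projections)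
      moreover have "flat_rank L1 (p1 K) \<le> flat_rank L1 X"
        using * X K(1) by (intro M1.rk_mono) (auto simp: low_def D_iff)
      ultimately show "m < flat_rank L1 X \<and> x \<in> X <+> join F"
        using K(3) defect_le[OF K(1)] False by auto
    qed
    \<comment> \<open>Every middle containing x lies above K and inherits its large defect.\<close>
    have "{H \<in> mids. x \<in> H} = {H \<in> {H \<in> mids. m < defect H}. x \<in> H}"
      using False defect_mono[OF K(1) mids] by fastforce
    also have "\<dots> = (\<lambda>X. X <+> join F) ` {X \<in> P. m < flat_rank L1 X \<and> x \<in> X <+> join F}"
      unfolding mids_high if_P[OF d] by blast
    also have "{X \<in> P. m < flat_rank L1 X \<and> x \<in> X <+> join F} = {X \<in> P. p1 K \<subseteq> X}"
      by (intro Collect_cong conj_cong refl key)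
    finally have eq: "{H \<in> mids. x \<in> H} = (\<lambda>X. X <+> join F) ` {X \<in> P. p1 K \<subseteq> X}" .
    have "(\<Sum>H\<in>{H \<in> mids. x \<in> H}. edge_wt (Suc m) H G) =
        (\<Sum>X\<in>{X \<in> P. p1 K \<subseteq> X}. edge_wt (Suc m) (X <+> join F) G)"
      unfolding eq by (simp add: sum.reindex[OF inj_Plus])
    also have "\<dots> = (\<Sum>X\<in>{X \<in> P. p1 K \<subseteq> X}. eta (low X (p1 G) (join F)) X)"
    proof (rule sum.cong)
      fix X assume X: "X \<in> {X \<in> P. p1 K \<subseteq> X}"
      then have "m < flat_rank L1 X" using key[of X] by simp
      then show "edge_wt (Suc m) (X <+> join F) G = eta (low X (p1 G) (join F)) X"
        using X edge_wt_high by simp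
    qed simp
    also have "\<dots> = 1" by (rule sum_eta_low[OF p1K])
    finally show ?thesis .
  qed
qed

lemma edges_iff:
  "edge (Suc m) F H \<and> edge (Suc m) H G \<longleftrightarrow> H \<in> mids \<and> edge_wt (Suc m) H G \<noteq> 0"
  using F G grade_G edge_wt_from_F by (auto simp: edge_def mids_def)

lemma nonempty: "G - F \<noteq> {}"
  using FG grade_G by auto

text \<open>If all weights towards G vanished, the sum over the middles containing a given point of
  G - F would be 0 instead of 1. The segment is therefore present even when the new weight is
  0.\<close>

lemma ex_edges: "\<exists>H. edge (Suc m) F H \<and> edge (Suc m) H G"
proof (rule ccontr)
  assume "\<nexists>H. edge (Suc m) F H \<and> edge (Suc m) H G"
  then have "edge_wt (Suc m) H G = 0" if "H \<in> mids" for H using that edges_iff by blast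
  then have "(\<Sum>H\<in>{H \<in> mids. x \<in> H}. edge_wt (Suc m) H G) = 0" for x
    by (intro sum.neutral) auto
  then show False using sum_mids_containing nonempty by fastforce
qed

end

section \<open>The modification step\<close>

text \<open>The vector to be evaluated in a segment weight will turn out to be that of the top
  element, and its representation must be shown unique. A point x outside all members of the flag
  other than B forces the coefficient of B to be 1; a point y in all members forces the coefficients
  to add up to 1. The remaining ones are nonnegative with sum 0, so they vanish.\<close>

lemma segment_fan_value_top:
  assumes fin: "finite (verts G)" "finite B"
    and le_subset: "\<And>X Y. le G X Y \<Longrightarrow> X \<subseteq> Y"
    and B: "B \<in> verts G" "le G A B" "le G B B" "A \<noteq> B"
  shows "segment_fan_value G \<phi> A B (char_vec (B - A)) = \<phi> B"
  unfolding segment_fan_value_def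
proof (rule the_equality)
  show "\<exists>C c. C \<subseteq> {X \<in> verts G. le G A X \<and> X \<noteq> A \<and> le G X B} \<and>
     (\<forall>X\<in>C. \<forall>Y\<in>C. le G X Y \<or> le G Y X) \<and> (\<forall>X\<in>C - {B}. 0 \<le> c X) \<and>
     char_vec (B - A) = (\<lambda>x. \<Sum>X\<in>C. c X * char_vec (X - A) x) \<and>
     \<phi> B = (\<Sum>X\<in>C. c X * \<phi> X)"
    using B by (intro exI[of _ "{B}"] exI[of _ "\<lambda>_. 1"]) auto
next
  fix t
  assume "\<exists>C c. C \<subseteq> {X \<in> verts G. le G A X \<and> X \<noteq> A \<and> le G X B} \<and>
     (\<forall>X\<in>C. \<forall>Y\<in>C. le G X Y \<or> le G Y X) \<and> (\<forall>X\<in>C - {B}. 0 \<le> c X) \<and>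
     char_vec (B - A) = (\<lambda>x. \<Sum>X\<in>C. c X * char_vec (X - A) x) \<and>
     t = (\<Sum>X\<in>C. c X * \<phi> X)"
  then obtain C c where C: "C \<subseteq> {X \<in> verts G. le G A X \<and> X \<noteq> A \<and> le G X B}"
    and chain: "\<forall>X\<in>C. \<forall>Y\<in>C. le G X Y \<or> le G Y X"
    and nonneg: "\<forall>X\<in>C - {B}. 0 \<le> c X"
    and v: "char_vec (B - A) = (\<lambda>x. \<Sum>X\<in>C. c X * char_vec (X - A) x)"
    and t: "t = (\<Sum>X\<in>C. c X * \<phi> X)" by blast
  have v': "(\<Sum>X\<in>C. c X * char_vec (X - A) x) = of_bool (x \<in> B - A)" for x
    using fun_cong[OF v, of x] by (simp add: char_vec_def)
  have finC: "finite C" using C fin(1) by (rule_tac finite_subset[of C "verts G"]) auto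
  have AB: "A \<subset> B" using le_subset[OF B(2)] B(4) by auto
  have CX: "A \<subset> X" "X \<subseteq> B" if "X \<in> C" for X
    using that C le_subset[of A X] le_subset[of X B] by auto
  have chain': "X \<subseteq> Y \<or> Y \<subseteq> X" if "X \<in> C" "Y \<in> C" for X Y
    using that chain le_subset by blast
  define C0 where "C0 = C - {B}"
  have split: "(\<Sum>X\<in>C. g X) = (if B \<in> C then g B else 0) + (\<Sum>X\<in>C0. g X)"
    for g :: "_ \<Rightarrow> int"
    using finC by (simp add: C0_def sum.remove[of C B])
  have fin0: "finite C0" using finC by (simp add: C0_def)
  \<comment> \<open>Such a point exists outside the largest member of the flag below B.\<close>
  obtain x where x: "x \<in> B - A" "\<forall>X\<in>C0. x \<notin> X"
  proof (cases "C0 = {}")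
    case True
    then show ?thesis using AB that by blast
  next
    case False
    then obtain M where M: "M \<in> C0" "\<forall>X\<in>C0. M \<subseteq> X \<longrightarrow> M = X"
      using finite_has_maximal[OF fin0] by blast
    have "X \<subseteq> M" if "X \<in> C0" for X
      using that M chain'[of X M] by (auto simp: C0_def)
    moreover have "A \<subset> M" "M \<subset> B" using M CX[of M] by (auto simp: C0_def)
    ultimately show ?thesis using that by blast
  qed
  \<comment> \<open>Such a point exists in the smallest member of the flag, which contains A
    strictly.\<close>
  obtain y where y: "y \<in> B - A" "\<forall>X\<in>C. y \<in> X"
  proof (cases "C = {}")
    case True
    then show ?thesis using AB that by blast
  next
    case False
    then obtain M where M: "M \<in> C" "\<forall>X\<in>C. X \<subseteq> M \<longrightarrow> M = X"
      using finite_has_minimal[OF finC] by blast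
    have "M \<subseteq> X" if "X \<in> C" for X
      using that M chain'[of X M] by auto
    moreover have "A \<subset> M" "M \<subseteq> B" using M CX[of M] by auto
    ultimately show ?thesis using that by blast
  qed
  have "c X * char_vec (X - A) x = 0" if "X \<in> C0" for X
    using that x by (simp add: char_vec_def)
  then have "(\<Sum>X\<in>C0. c X * char_vec (X - A) x) = 0" by (rule sum.neutral[OF ballI])
  then have cB: "B \<in> C \<and> c B = 1"
    using v'[of x] x(1) unfolding split by (cases "B \<in> C") (auto simp: char_vec_def)
  have "c X * char_vec (X - A) y = c X" if "X \<in> C" for X
    using that y by (auto simp: char_vec_def)
  then have "(\<Sum>X\<in>C. c X) = (\<Sum>X\<in>C. c X * char_vec (X - A) y)" by (intro sum.cong) auto
  then have "(\<Sum>X\<in>C. c X) = 1" using v'[of y] y(1) by simp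
  then have "(\<Sum>X\<in>C0. c X) = 0" using cB by (simp add: split)
  then have "\<forall>X\<in>C0. c X = 0"
    using nonneg sum_nonneg_eq_0_iff[OF fin0, of c] by (simp add: C0_def)
  then have "(\<Sum>X\<in>C0. c X * \<phi> X) = 0" by simp
  then show "t = \<phi> B" using t cB by (simp add: split)
qed

section \<open>The invariant and its initial case\<close>

context covering_map
begin

text \<open>The order is constrained only through its covers, since the initial pair uses inclusion
  and the later ones reachability. The last clause is convexity: it ensures that the middles of a
  segment, found among all admissible flats, are vertices of the pair.\<close>

definition stage :: "nat \<Rightarrow> ('a + 'b) flag_pair \<Rightarrow> bool" where
  "stage m G \<longleftrightarrow> verts G \<subseteq> admissible m \<and>
     (\<forall>A B. pair_covers G A B \<longleftrightarrow> A \<in> verts G \<and> B \<in> verts G \<and> edge m A B) \<and>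
     (\<forall>A B. pair_covers G A B \<longrightarrow> wt G A B = edge_wt m A B) \<and>
     (\<forall>A B. le G A B \<longrightarrow> A \<subseteq> B) \<and>
     (\<forall>A\<in>verts G. le G A A) \<and>
     (\<forall>A B C. le G A B \<longrightarrow> le G B C \<longrightarrow> le G A C) \<and>
     (\<forall>A B C. A \<in> verts G \<longrightarrow> C \<in> verts G \<longrightarrow> (edge m)\<^sup>*\<^sup>* A B \<longrightarrow> (edge m)\<^sup>*\<^sup>* B C \<longrightarrow> B \<in> verts G)"

lemma edge_subset: "edge m A B \<Longrightarrow> A \<subseteq> B"
  by (simp add: edge_def)

lemma edges_subset: "(edge m)\<^sup>*\<^sup>* A B \<Longrightarrow> A \<subseteq> B"
  by (induction rule: rtranclp_induct) (auto dest: edge_subset)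

lemma edges_grade: "(edge m)\<^sup>*\<^sup>* A B \<Longrightarrow> A = B \<or> grade m A < grade m B"
  by (induction rule: rtranclp_induct) (auto simp: edge_def)

text \<open>No defect exceeds rk M1, so grade and rank agree. A flat attaining this defect has first
  component \<open>E1\<close>; its poset \<open>low\<close> is then a singleton and eta is
  1.\<close>

lemma stage_bergman: "stage (flat_rank L1 E1) (bergman_pair D)"
proof -
  let ?r = "flat_rank L1 E1"
  have rk_le: "flat_rank L1 X \<le> ?r" if "X \<in> L1" for X
    using that M1.rk_mono M1.ground_flat M1.flat_subset by blast
  have defect_r: "defect F \<le> ?r" if "F \<in> D" for F
    using that defect_le[of F] rk_le[of "p1 F"] D_p1[of F] by linarith
  have grade: "grade ?r F = rank F" if "F \<in> D" for F
    using that defect_r by (simp add: grade_eq_rank)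
  have top: "defect F = flat_rank L1 (p1 F) \<and> p1 F = E1" if "F \<in> D" "?r \<le> defect F" for F
  proof -
    have *: "flat_rank L1 (p1 F) = defect F" "?r \<le> flat_rank L1 (p1 F)"
      using that defect_le[of F] rk_le[of "p1 F"] D_p1[of F] by linarith+
    then have "p1 F = E1"
      using that M1.rk_eq_imp_eq[of "p1 F" E1] D_p1[of F] M1.ground_flat M1.flat_subset by blast
    with * show ?thesis by simp
  qed
  have admissible: "admissible ?r = D"
    using top defect_eq_iff by (auto simp: admissible_def)
  have wt: "edge_wt ?r A B = 1" if "A \<in> D" "B \<in> D" "A \<subseteq> B" for A B
  proof (cases "?r \<le> defect A")
    case True
    then have "p1 A = E1" "f (p1 A) \<subseteq> p2 A" using top that defect_eq_iff by auto
    moreover from this have "p1 B = E1"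
      using that M1.flat_subset[of "p1 B"] D_p1[of B] by (auto simp: subset_iff_projections)
    ultimately show ?thesis
      using True eta_low_refl[of E1 "p2 A"] M1.ground_flat by (simp add: edge_wt_def)
  qed (simp add: edge_wt_def)
  have edge: "edge ?r A B \<longleftrightarrow> A \<in> D \<and> B \<in> D \<and> A \<subseteq> B \<and> rank B = Suc (rank A)" for A B
    using wt grade by (auto simp: edge_def admissible)
  have covers: "pair_covers (bergman_pair D) A B \<longleftrightarrow> A \<in> D \<and> B \<in> D \<and> edge ?r A B" for A B
  proof
    assume "pair_covers (bergman_pair D) A B"
    then have AB: "A \<in> D" "B \<in> D" "A \<subset> B"
      and mid: "\<And>C. C \<in> D \<Longrightarrow> A \<subseteq> C \<Longrightarrow> C \<subseteq> B \<Longrightarrow> C = A \<or> C = B"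
      by (auto simp: pair_covers_def covered_def bergman_pair_def)
    obtain x where x: "x \<in> B" "x \<notin> A" using AB by auto
    then have "x \<in> E1 <+> E2" using D_subset AB by blast
    then obtain K where K: "K \<in> D" "A \<subseteq> K" "x \<in> K" "rank K = Suc (rank A)" "K \<subseteq> B"
      using minimal_extension[OF AB(1) _ x(2)] AB x by (metis psubset_imp_subset)
    then have "K = B" using mid[of K] x by auto
    then show "A \<in> D \<and> B \<in> D \<and> edge ?r A B" using AB K by (simp add: edge)
  next
    assume *: "A \<in> D \<and> B \<in> D \<and> edge ?r A B"
    have "C = A \<or> C = B" if C: "C \<in> D" "A \<subseteq> C" "C \<subseteq> B" for C
    proof -
      have "rank C \<le> rank A \<or> rank B \<le> rank C" using * by (auto simp: edge)
      then show ?thesis using rank_eq_imp_eq[of A C] rank_eq_imp_eq[of C B] C * by auto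
    qed
    moreover have "A \<noteq> B" using * by (auto simp: edge)
    ultimately show "pair_covers (bergman_pair D) A B"
      using * by (auto simp: pair_covers_def covered_def bergman_pair_def edge)
  qed
  have "B \<in> D" if "A \<in> D" "(edge ?r)\<^sup>*\<^sup>* A B" for A B
    using that(2,1) by (induction rule: rtranclp_induct) (auto simp: edge)
  then show ?thesis
    using covers wt by (auto simp: stage_def admissible bergman_pair_def edge)
qed

end

section \<open>Preservation of the invariant by one step\<close>

locale modification = covering_map +
  fixes m :: nat and G :: "('a + 'b) flag_pair" and \<phi> :: "('a + 'b) set \<Rightarrow> int"
  assumes stage: "stage (Suc m) G"
    and \<phi>: "\<And>F. F \<in> D \<Longrightarrow> \<phi> F = (if defect F \<le> m then 0 else - 1)"
begin

lemma verts_admissible: "A \<in> verts G \<Longrightarrow> A \<in> admissible (Suc m)"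
  using stage by (auto simp: stage_def)

lemma verts_D: "A \<in> verts G \<Longrightarrow> A \<in> D"
  using verts_admissible admissible_D by blast

lemma covers: "pair_covers G A B \<longleftrightarrow> A \<in> verts G \<and> B \<in> verts G \<and> edge (Suc m) A B"
  using stage by (simp add: stage_def)

lemma wt: "pair_covers G A B \<Longrightarrow> wt G A B = edge_wt (Suc m) A B"
  using stage by (simp add: stage_def)

lemma le_subset: "le G A B \<Longrightarrow> A \<subseteq> B"
  using stage by (simp add: stage_def)

lemma vert_le_refl: "A \<in> verts G \<Longrightarrow> le G A A"
  using stage by (simp add: stage_def)

lemma vert_le_trans: "le G A B \<Longrightarrow> le G B C \<Longrightarrow> le G A C"
  using stage unfolding stage_def by blast

lemma convex:
  "A \<in> verts G \<Longrightarrow> C \<in> verts G \<Longrightarrow> (edge (Suc m))\<^sup>*\<^sup>* A B \<Longrightarrow> (edge (Suc m))\<^sup>*\<^sup>* B C \<Longrightarrow> B \<in> verts G"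
  using stage unfolding stage_def by blast

lemma between_eq:
  assumes "A \<in> verts G" "B \<in> verts G"
  shows "between G A B = {H. edge (Suc m) A H \<and> edge (Suc m) H B}"
  unfolding between_def using convex[OF assms] assms
  by (auto simp: covers)

lemma phi_eq_iff:
  "A \<in> D \<Longrightarrow> B \<in> D \<Longrightarrow> \<phi> A = \<phi> B \<longleftrightarrow> (defect A \<le> m \<longleftrightarrow> defect B \<le> m)"
  by (auto simp: \<phi>)

lemma critical_segmentI:
  assumes "A \<in> admissible (Suc m)" "B \<in> admissible (Suc m)" "\<phi> A \<noteq> \<phi> B"
    and "A \<subseteq> B" "grade m B = Suc (grade m A)"
  shows "critical_segment E1 L1 E2 L2 f m A B"
proof unfold_locales
  have D: "A \<in> D" "B \<in> D" using assms admissible_D by auto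
  show "defect A \<le> m" "m < defect B"
    using assms(3) phi_eq_iff[OF D] defect_mono[OF D assms(4)] by auto
qed (use assms in auto)

text \<open>By \<open>sum_mids_high\<close> the first term is the new weight minus 1. By
  \<open>sum_mids_containing\<close> the vector in the second term is that of B - A, where the
  function takes the value \<open>\<phi> B = - 1\<close>. The difference is the new weight.\<close>

lemma critical_weight:
  assumes AB: "A \<in> verts G" "B \<in> verts G"
    and "critical_segment E1 L1 E2 L2 f m A B"
  shows "segment_weight G \<phi> A B = edge_wt m A B"
proof -
  interpret critical_segment E1 L1 E2 L2 f m A B by fact
  let ?M = "between G A B"
  let ?w = "\<lambda>H. wt G A H * wt G H B"
  have M: "H \<in> ?M \<longleftrightarrow> H \<in> mids \<and> edge_wt (Suc m) H B \<noteq> 0" for H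
    using between_eq[OF AB] edges_iff by simp
  have sum_M: "(\<Sum>H\<in>?M. ?w H * g H) = (\<Sum>H\<in>mids. edge_wt (Suc m) H B * g H)" for g :: "_ \<Rightarrow> int"
  proof -
    have "?w H = edge_wt (Suc m) H B" if "H \<in> ?M" for H
      using that wt edge_wt_from_F by (simp add: between_def)
    then have "(\<Sum>H\<in>?M. ?w H * g H) = (\<Sum>H\<in>?M. edge_wt (Suc m) H B * g H)"
      by (intro sum.cong) auto
    also have "\<dots> = (\<Sum>H\<in>mids. edge_wt (Suc m) H B * g H)"
      using M finite_mids by (intro sum.mono_neutral_left) auto
    finally show ?thesis .
  qed
  have "(\<Sum>H\<in>?M. ?w H * \<phi> H) = (\<Sum>H\<in>mids. edge_wt (Suc m) H B * (- of_bool (m < defect H)))"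
    unfolding sum_M using admissible_D by (intro sum.cong) (auto simp: \<phi> mids_def)
  also have "\<dots> = - (\<Sum>H\<in>{H \<in> mids. m < defect H}. edge_wt (Suc m) H B)"
    using finite_mids by (simp add: of_bool_def sum.If_cases sum_negf Int_def if_distrib cong: if_cong)
  finally have val: "(\<Sum>H\<in>?M. ?w H * \<phi> H) = edge_wt m A B - 1"
    by (simp add: sum_mids_high)
  have vec: "(\<lambda>x. \<Sum>H\<in>?M. ?w H * char_vec (H - A) x) = char_vec (B - A)"
  proof
    fix x
    have "(\<Sum>H\<in>?M. ?w H * char_vec (H - A) x) =
        (\<Sum>H\<in>mids. edge_wt (Suc m) H B * of_bool (x \<in> H \<and> x \<notin> A))"
      unfolding sum_M by (simp add: char_vec_def)
    also have "\<dots> = of_bool (x \<in> B - A)"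
    proof (cases "x \<in> B - A")
      case True
      then have "(\<Sum>H\<in>mids. edge_wt (Suc m) H B * of_bool (x \<in> H \<and> x \<notin> A)) =
          (\<Sum>H\<in>{H \<in> mids. x \<in> H}. edge_wt (Suc m) H B)"
        using finite_mids by (simp add: of_bool_def sum.If_cases Int_def if_distrib cong: if_cong)
      then show ?thesis using sum_mids_containing True by simp
    next
      case False
      then show ?thesis by (auto simp: mids_def intro!: sum.neutral)
    qed
    finally show "(\<Sum>H\<in>?M. ?w H * char_vec (H - A) x) = char_vec (B - A) x"
      by (simp add: char_vec_def)
  qed
  obtain H where "edge (Suc m) A H \<and> edge (Suc m) H B" using ex_edges by blast
  then have "H \<in> ?M" using between_eq[OF AB] by simp
  then have "le G A B" using vert_le_trans[of A H B]
    by (auto simp: between_def pair_covers_def covered_def)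
  moreover have "finite (verts G)" using finite_D verts_D by (meson finite_subset subsetI)
  ultimately have "segment_fan_value G \<phi> A B (char_vec (B - A)) = \<phi> B"
    using AB nonempty finite_member_D verts_D le_subset vert_le_refl by (intro segment_fan_value_top) auto
  then show ?thesis
    using val defect_G G_D by (simp add: segment_weight_def vec \<phi>)
qed

text \<open>A middle vertex gives grade difference two at threshold \<open>Suc m\<close>, and
  lowering the threshold takes one off B only. Conversely the grade condition makes the segment
  critical, so \<open>ex_edges\<close> provides a middle vertex.\<close>

lemma modified_edge_crossing:
  assumes AB: "A \<in> verts G" "B \<in> verts G" and ne: "\<phi> A \<noteq> \<phi> B"
  shows "modified_edges G \<phi> A B \<longleftrightarrow>
    A \<subseteq> B \<and> grade m B = Suc (grade m A) \<and> edge_wt m A B \<noteq> 0"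
proof -
  have sub: "A \<subseteq> B \<and> grade m B = Suc (grade m A)" if ne': "between G A B \<noteq> {}"
  proof -
    obtain H where H: "edge (Suc m) A H" "edge (Suc m) H B"
      using ne' between_eq[OF AB] by auto
    then have sub: "A \<subseteq> B" and gr: "grade (Suc m) B = Suc (Suc (grade (Suc m) A))"
      by (auto simp: edge_def)
    then have "defect A \<le> m" "m < defect B"
      using ne phi_eq_iff[of A B] verts_D[OF AB(1)] verts_D[OF AB(2)] defect_mono[of A B] by auto
    with sub gr show ?thesis by (simp add: grade_def)
  qed
  have mod: "modified_edges G \<phi> A B \<longleftrightarrow> between G A B \<noteq> {} \<and> segment_weight G \<phi> A B \<noteq> 0"
    using ne by (simp add: modified_edges_def)
  show ?thesis
  proof (cases "A \<subseteq> B \<and> grade m B = Suc (grade m A)")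
    case True
    then have "critical_segment E1 L1 E2 L2 f m A B"
      using critical_segmentI AB ne verts_admissible by blast
    then have "between G A B \<noteq> {}" "segment_weight G \<phi> A B = edge_wt m A B"
      using critical_segment.ex_edges between_eq[OF AB] critical_weight[OF AB] by auto
    then show ?thesis using mod True by simp
  next
    case False
    then show ?thesis using mod sub by blast
  qed
qed

text \<open>Lowering the threshold shifts both grades equally. The weight formulas differ only for
  defect m at A; then B has defect m as well, admissibility forces equal first components, and the
  eta value is 1.\<close>

lemma edge_same_side:
  assumes AB: "A \<in> admissible m" "B \<in> admissible m" and eq: "\<phi> A = \<phi> B"
  shows "edge (Suc m) A B \<longleftrightarrow> edge m A B"
    and "edge (Suc m) A B \<Longrightarrow> edge_wt (Suc m) A B = edge_wt m A B"
proof -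
  have D: "A \<in> D" "B \<in> D" using AB admissible_D by auto
  have side: "defect A \<le> m \<longleftrightarrow> defect B \<le> m" using phi_eq_iff D eq by auto
  have grade: "grade (Suc m) B = Suc (grade (Suc m) A) \<longleftrightarrow> grade m B = Suc (grade m A)"
    using side by (auto simp: grade_def min_def)
  have wt: "edge_wt (Suc m) A B = edge_wt m A B"
    if "A \<subseteq> B" "grade m B = Suc (grade m A)"
  proof (cases "defect A = m")
    case True
    then have dB: "defect B = m" using side defect_mono[OF D that(1)] by simp
    then have f: "f (p1 A) \<subseteq> p2 A" "f (p1 B) \<subseteq> p2 B"
      using AB True by (auto simp: admissible_def)
    then have "flat_rank L1 (p1 B) \<le> flat_rank L1 (p1 A)"
      using True dB defect_eq_iff[OF D(1)] defect_eq_iff[OF D(2)] by simp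
    then have "p1 A = p1 B"
      using D that(1) by (intro M1.rk_eq_imp_eq) (auto simp: D_iff)
    then show ?thesis
      using True f eta_low_refl[of "p1 A" "p2 A"] D by (simp add: edge_wt_def D_iff)
  qed (auto simp: edge_wt_def)
  show "edge (Suc m) A B \<longleftrightarrow> edge m A B"
    using AB grade wt admissible_Suc by (auto simp: edge_def)
  show "edge_wt (Suc m) A B = edge_wt m A B" if "edge (Suc m) A B"
    using that grade wt by (simp add: edge_def)
qed

lemma edge_imp_modified_edge:
  assumes AB: "A \<in> verts G" "B \<in> verts G" and "edge m A B"
  shows "modified_edges G \<phi> A B"
proof (cases "\<phi> A = \<phi> B")
  case True
  moreover have "A \<in> admissible m" "B \<in> admissible m" using assms(3) by (auto simp: edge_def)
  ultimately have "edge (Suc m) A B" using assms(3) edge_same_side(1)[of A B] by simp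
  then show ?thesis using True AB by (simp add: modified_edges_def covers)
next
  case False
  then show ?thesis using assms modified_edge_crossing by (simp add: edge_def)
qed

lemma modified_edge_verts:
  assumes "modified_edges G \<phi> A B"
  shows "A \<in> verts G" "B \<in> verts G" "A \<subseteq> B"
proof -
  consider "pair_covers G A B" | H where "pair_covers G A H" "pair_covers G H B"
    using assms unfolding modified_edges_def between_def by blast
  then have "A \<in> verts G \<and> B \<in> verts G \<and> A \<subseteq> B"
    by cases (auto simp: covers dest!: edge_subset)
  then show "A \<in> verts G" "B \<in> verts G" "A \<subseteq> B" by auto
qed

text \<open>Admissibility travels down along modified edges; only defect m at A is in question. If
  the function is constant, B has defect m too and the first component of A has rank at most m,
  which forces equality in \<open>defect_le\<close>. Otherwise a violation at A would make the
  weight 0. As the top is admissible, so is every vertex from which it can be reached.\<close>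

lemma modified_edge_imp_edge:
  assumes e: "modified_edges G \<phi> A B" and B: "B \<in> admissible m"
  shows "A \<in> admissible m \<and> edge m A B"
proof -
  note AB = modified_edge_verts[OF e]
  have D: "A \<in> D" "B \<in> D" using AB verts_D by auto
  have adm: "A \<in> admissible m"
  proof (cases "defect A = m")
    case dA: True
    have "f (p1 A) \<subseteq> p2 A"
    proof (cases "\<phi> A = \<phi> B")
      case True
      then have dB: "defect B = m"
        using dA phi_eq_iff[OF D] defect_mono[OF D AB(3)] by auto
      then have "defect B = flat_rank L1 (p1 B)"
        using B defect_eq_iff[OF D(2)] by (simp add: admissible_def)
      then have "flat_rank L1 (p1 A) \<le> defect A"
        using dA dB M1.rk_mono[of "p1 A" "p1 B"] AB(3) D by (auto simp: D_iff)
      then show ?thesis using defect_eq_iff[OF D(1)] defect_le[OF D(1)] by simp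
    next
      case False
      then have "edge_wt m A B \<noteq> 0" using e AB modified_edge_crossing by simp
      then show ?thesis using dA eta_low_eq_0[of "p1 A" "p2 A" "p1 B"] D_p1[OF D(1)] by (auto simp: edge_wt_def)
    qed
    then show ?thesis using D by (simp add: admissible_def)
  next
    case False
    then show ?thesis using verts_admissible[OF AB(1)] by (auto simp: admissible_def)
  qed
  moreover have "edge m A B"
  proof (cases "\<phi> A = \<phi> B")
    case True
    then have "edge (Suc m) A B" using e by (simp add: modified_edges_def covers)
    then show ?thesis using edge_same_side(1)[OF adm B True] by simp
  next
    case False
    then show ?thesis using e AB adm B modified_edge_crossing by (simp add: edge_def)
  qed
  ultimately show ?thesis by simp
qed

lemma top_admissible: "E1 <+> E2 \<in> admissible n"
  using top_D f_flat[OF M1.ground_flat] M2.flat_subset by (simp add: admissible_def)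

lemma modified_verts_admissible:
  assumes "A \<in> modified_verts (E1 <+> E2) G \<phi>"
  shows "A \<in> admissible m"
proof -
  have "(modified_edges G \<phi>)\<^sup>*\<^sup>* A (E1 <+> E2)" using assms by (simp add: modified_verts_def)
  then show ?thesis
    by (induction rule: converse_rtranclp_induct) (auto simp: top_admissible dest: modified_edge_imp_edge)
qed

lemma modified_edge_iff:
  assumes "A \<in> modified_verts (E1 <+> E2) G \<phi>" "B \<in> modified_verts (E1 <+> E2) G \<phi>"
  shows "modified_edges G \<phi> A B \<longleftrightarrow> edge m A B"
  using assms modified_edge_imp_edge edge_imp_modified_edge modified_verts_admissible
  by (auto simp: modified_verts_def)

lemma modified_path:
  assumes "(modified_edges G \<phi>)\<^sup>*\<^sup>* A B" "B \<in> admissible m"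
  shows "(edge m)\<^sup>*\<^sup>* A B"
proof -
  have "A \<in> admissible m \<and> (edge m)\<^sup>*\<^sup>* A B"
    using assms
    by (induction rule: converse_rtranclp_induct)
      (auto dest: modified_edge_imp_edge intro: converse_rtranclp_into_rtranclp)
  then show ?thesis ..
qed

text \<open>A crossing edge comes from a segment of length two at the previous threshold. Hence new
  paths refine to old ones, and convexity of the old vertex set applies to them.\<close>

lemma edge_imp_edges:
  assumes e: "edge m A B"
  shows "(edge (Suc m))\<^sup>*\<^sup>* A B"
proof (cases "\<phi> A = \<phi> B")
  case True
  then show ?thesis using e edge_same_side(1)[of A B] by (auto simp: edge_def)
next
  case False
  then have "critical_segment E1 L1 E2 L2 f m A B"
    using e admissible_Suc by (intro critical_segmentI) (auto simp: edge_def)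
  then obtain H where "edge (Suc m) A H" "edge (Suc m) H B"
    using critical_segment.ex_edges by blast
  then show ?thesis by auto
qed

lemma edges_Suc: "(edge m)\<^sup>*\<^sup>* A B \<Longrightarrow> (edge (Suc m))\<^sup>*\<^sup>* A B"
  by (induction rule: rtranclp_induct) (auto dest: edge_imp_edges)

lemma edges_imp_modified_path:
  assumes "A \<in> verts G" "C \<in> verts G" "(edge m)\<^sup>*\<^sup>* A B" "(edge m)\<^sup>*\<^sup>* B C"
  shows "(modified_edges G \<phi>)\<^sup>*\<^sup>* A B"
  using assms(3,4)
proof (induction rule: rtranclp_induct)
  case (step B B')
  have B: "(edge m)\<^sup>*\<^sup>* B C" "(edge m)\<^sup>*\<^sup>* A B'" using step by auto
  have "B \<in> verts G" "B' \<in> verts G"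
    using convex[OF assms(1,2)] edges_Suc step B by blast+
  then have "modified_edges G \<phi> B B'" using step edge_imp_modified_edge by blast
  then show ?case using step.IH B by auto
qed simp

lemma modified_convex:
  assumes A: "A \<in> modified_verts (E1 <+> E2) G \<phi>" and C: "C \<in> modified_verts (E1 <+> E2) G \<phi>"
    and AB: "(edge m)\<^sup>*\<^sup>* A B" and BC: "(edge m)\<^sup>*\<^sup>* B C"
  shows "B \<in> modified_verts (E1 <+> E2) G \<phi>"
proof -
  have v: "A \<in> verts G" "C \<in> verts G" using A C by (auto simp: modified_verts_def)
  then have B: "B \<in> verts G" using convex edges_Suc AB BC by blast
  have "(modified_edges G \<phi>)\<^sup>*\<^sup>* A B" using edges_imp_modified_path v AB BC by blast
  moreover have "(modified_edges G \<phi>)\<^sup>*\<^sup>* B C"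
    using edges_imp_modified_path[OF B v(2) BC] by blast
  ultimately show ?thesis using A C B by (auto simp: modified_verts_def)
qed

lemma stage_modify: "stage m (modify (E1 <+> E2) \<phi> G)"
proof -
  let ?V = "modified_verts (E1 <+> E2) G \<phi>"
  let ?G = "modify (E1 <+> E2) \<phi> G"
  have V: "verts ?G = ?V" by (simp add: modify_def)
  have le_iff: "le ?G A B \<longleftrightarrow> A \<in> ?V \<and> B \<in> ?V \<and> (modified_edges G \<phi>)\<^sup>*\<^sup>* A B" for A B
    by (simp add: modify_def)
  have le_edges: "(edge m)\<^sup>*\<^sup>* A B" if "le ?G A B" for A B
    using that modified_path modified_verts_admissible by (auto simp: le_iff)
  have V_verts: "A \<in> verts G" if "A \<in> ?V" for A using that by (simp add: modified_verts_def)
  have covers': "pair_covers ?G A B \<longleftrightarrow> A \<in> ?V \<and> B \<in> ?V \<and> edge m A B" for A B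
  proof
    assume "pair_covers ?G A B"
    then have AB: "A \<in> ?V" "B \<in> ?V" "le ?G A B" "A \<noteq> B"
      and mid: "\<And>C. C \<in> ?V \<Longrightarrow> le ?G A C \<Longrightarrow> le ?G C B \<Longrightarrow> C = A \<or> C = B"
      by (auto simp: pair_covers_def covered_def V)
    \<comment> \<open>The first edge of a path from A to B. Its end C is a surviving vertex by
      convexity, so the cover property forces C = B.\<close>
    then obtain C where C: "edge m A C" "(edge m)\<^sup>*\<^sup>* C B"
      using le_edges[OF AB(3)] by (metis converse_rtranclpE)
    then have CV: "C \<in> ?V" using modified_convex[OF AB(1,2)] by blast
    have "le ?G A C" using C(1) modified_edge_iff AB(1) CV by (auto simp: le_iff)
    moreover have "le ?G C B"
      using edges_imp_modified_path[OF V_verts[OF CV] V_verts[OF AB(2)] C(2)] CV AB(2) by (simp add: le_iff)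
    moreover have "C \<noteq> A" using C(1) by (auto simp: edge_def)
    ultimately have "C = B" using mid CV by blast
    then show "A \<in> ?V \<and> B \<in> ?V \<and> edge m A B" using AB C by simp
  next
    assume *: "A \<in> ?V \<and> B \<in> ?V \<and> edge m A B"
    \<comment> \<open>Proper steps in the order raise the grade, and an edge raises it by exactly
      one, leaving no room for a vertex in between.\<close>
    have "C = A \<or> C = B" if C: "le ?G A C" "le ?G C B" for C
      using edges_grade[OF le_edges[OF C(1)]] edges_grade[OF le_edges[OF C(2)]] *
      by (auto simp: edge_def)
    moreover have "le ?G A B" using * modified_edge_iff by (auto simp: le_iff)
    moreover have "A \<noteq> B" using * by (auto simp: edge_def)
    ultimately show "pair_covers ?G A B" using * by (auto simp: pair_covers_def covered_def V)
  qed
  have wt': "wt ?G A B = edge_wt m A B" if "A \<in> ?V" "B \<in> ?V" "edge m A B" for A B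
  proof -
    have AB: "A \<in> admissible m" "B \<in> admissible m" "A \<in> verts G" "B \<in> verts G"
      using that modified_verts_admissible V_verts by auto
    show ?thesis
    proof (cases "\<phi> A = \<phi> B")
      case True
      then show ?thesis
        using that AB edge_same_side[OF AB(1,2) True] wt covers by (simp add: modify_def)
    next
      case False
      then have "critical_segment E1 L1 E2 L2 f m A B"
        using AB verts_admissible that(3) by (intro critical_segmentI) (auto simp: edge_def)
      then show ?thesis using False AB critical_weight by (simp add: modify_def)
    qed
  qed
  show ?thesis
    unfolding stage_def
  proof (intro conjI allI impI ballI)
    show "verts ?G \<subseteq> admissible m" using modified_verts_admissible V by auto
    show "pair_covers ?G A B = (A \<in> verts ?G \<and> B \<in> verts ?G \<and> edge m A B)" for A B
      by (simp add: covers' V)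
    show "wt ?G A B = edge_wt m A B" if "pair_covers ?G A B" for A B
      using that wt' by (simp add: covers')
    show "A \<subseteq> B" if "le ?G A B" for A B using that le_edges edges_subset by blast
    show "le ?G A A" if "A \<in> verts ?G" for A using that by (simp add: V le_iff)
    show "le ?G A C" if "le ?G A B" "le ?G B C" for A B C using that by (auto simp: le_iff)
    show "B \<in> verts ?G" if "A \<in> verts ?G" "C \<in> verts ?G" "(edge m)\<^sup>*\<^sup>* A B" "(edge m)\<^sup>*\<^sup>* B C" for A B C
      unfolding V by (rule modified_convex[OF that(1,2)[unfolded V] that(3,4)])
  qed
qed

end

section \<open>Iteration down to threshold 0\<close>

context covering_map
begin

lemma gamma_fun_eq:
  assumes "F \<in> D"
  shows "gamma_fun E1 L1 L2 f i F = (if defect F \<le> flat_rank L1 E1 - i then 0 else - 1)"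
proof -
  have "flat_rank L2 (f (p1 F) \<union> p2 F) = flat_rank L2 (join F)" using assms rk_join by simp
  then have "flat_rank L2 (f (p1 F) \<union> p2 F) + (flat_rank L1 E1 - i) \<ge> rank F \<longleftrightarrow>
      defect F \<le> flat_rank L1 E1 - i"
    using defect_add[OF assms] by linarith
  then show ?thesis by (simp add: gamma_fun_def rank_def)
qed

lemma stage_fold:
  assumes "n \<le> flat_rank L1 E1"
  shows "stage (flat_rank L1 E1 - n)
    (fold (\<lambda>i. modify (E1 <+> E2) (gamma_fun E1 L1 L2 f i)) [1..<Suc n] (bergman_pair D))"
  using assms
proof (induction n)
  case 0
  then show ?case using stage_bergman by simp
next
  case (Suc n)
  let ?G = "fold (\<lambda>i. modify (E1 <+> E2) (gamma_fun E1 L1 L2 f i)) [1..<Suc n] (bergman_pair D)"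
  let ?m = "flat_rank L1 E1 - Suc n"
  have "stage (Suc ?m) ?G" using Suc by (simp add: Suc_diff_Suc)
  then interpret modification E1 L1 E2 L2 f ?m ?G "gamma_fun E1 L1 L2 f (Suc n)"
    by unfold_locales (simp_all add: gamma_fun_eq)
  show ?case using stage_modify by simp
qed

lemma stage_graph_pair: "stage 0 (graph_pair E1 L1 E2 L2 f)"
  using stage_fold[of "flat_rank L1 E1"] by (simp add: graph_pair_def)

end

theorem theorem5p12:
  fixes E1 :: "'a set" and L1 :: "'a set set"
    and E2 :: "'b set" and L2 :: "'b set set"
    and f :: "'a set \<Rightarrow> 'b set"
    and \<G> :: "('a + 'b) flag_pair"
  assumes "simple_matroid E1 L1" and "simple_matroid E2 L2"
    and "covering_lattice_map L1 L2 f"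
    and "\<G> = graph_pair E1 L1 E2 L2 f"
  shows "(\<forall>P Q. pair_covers \<G> P Q \<longrightarrow>
      (\<exists>X1\<in>L1. \<exists>Y1\<in>L2. \<exists>X2\<in>L1. \<exists>Y2\<in>L2.
        P = X1 <+> Y1 \<and> Q = X2 <+> Y2 \<and>
        covered L2 (\<subseteq>) Y1 Y2 \<and> f X1 \<subseteq> Y1 \<and> X1 \<subseteq> X2)) \<and>
    (\<forall>X1 Y1 X2 Y2. pair_covers \<G> (X1 <+> Y1) (X2 <+> Y2) \<longrightarrow>
        wt \<G> (X1 <+> Y1) (X2 <+> Y2) =
          eta {F\<in>L1. X1 \<subseteq> F \<and> F \<subseteq> X2 \<and> f F \<subseteq> Y1} X1)"
proof -
  interpret M1: simple_matroid E1 L1 by fact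
  interpret M2: simple_matroid E2 L2 by fact
  interpret covering_map E1 L1 E2 L2 f by unfold_locales fact
  have stage: "stage 0 \<G>" using stage_graph_pair assms(4) by simp
  show ?thesis
  proof (intro conjI allI impI)
    fix A B assume "pair_covers \<G> A B"
    then have e: "edge 0 A B" using stage by (simp add: stage_def)
    then have D: "A \<in> D" "B \<in> D" and sub: "p1 A \<subseteq> p1 B" "p2 A \<subseteq> p2 B"
      and f: "f (p1 A) \<subseteq> p2 A" "f (p1 B) \<subseteq> p2 B" and gr: "grade 0 B = Suc (grade 0 A)"
      by (auto simp: edge_def admissible_def)
    \<comment> \<open>At threshold 0 the grade is the rank of the join, which here is the second
      component.\<close>
    have "covered L2 (\<subseteq>) (p2 A) (p2 B)"
      using gr sub join_eq[OF D(1) f(1)] join_eq[OF D(2) f(2)] D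
      by (intro M2.flat_coverI) (auto simp: grade_def D_iff)
    with D sub f show "\<exists>X1\<in>L1. \<exists>Y1\<in>L2. \<exists>X2\<in>L1. \<exists>Y2\<in>L2.
        A = X1 <+> Y1 \<and> B = X2 <+> Y2 \<and> covered L2 (\<subseteq>) Y1 Y2 \<and> f X1 \<subseteq> Y1 \<and> X1 \<subseteq> X2"
      by (intro bexI[of _ "p1 A"] bexI[of _ "p2 A"] bexI[of _ "p1 B"] bexI[of _ "p2 B"])
        (simp_all add: D_iff)
  next
    fix X1 Y1 X2 Y2 assume "pair_covers \<G> (X1 <+> Y1) (X2 <+> Y2)"
    then show "wt \<G> (X1 <+> Y1) (X2 <+> Y2) =
          eta {F\<in>L1. X1 \<subseteq> F \<and> F \<subseteq> X2 \<and> f F \<subseteq> Y1} X1"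
      \<comment> \<open>Every defect is at least 0, so the eta branch of \<open>edge_wt\<close>
        always applies.\<close>
      using stage by (simp add: stage_def edge_wt_def low_def)
  qed
qed

end
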